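(* Let $Q$ be a finite quiver, let $M\in\mathrm{rep}_{\mathbb{C}}(Q)$ be straight with straightening basis $B$, and let $\mathbf{e}\in\mathbb{Z}^{Q_0}$. Then the torus $T_M$ acts on $\mathrm{Gr}_{\mathbf{e}}(M)$ with finitely many one-dimensional orbits.
   Context: A quiver $Q$ has vertex set $Q_0$ and arrow set $Q_1$; an arrow $a$ has source $s_a$ and target $t_a$. $\mathrm{rep}_{\mathbb{C}}(Q)$ is the category of finite-dimensional complex representations $M=((M^{(i)})_{i\in Q_0},(M_a)_{a\in Q_1})$. The quiver Grassmannian $\mathrm{Gr}_{\mathbf e}(M)$ is the closed subvariety of $\prod_{i\in Q_0}\mathrm{Gr}_{e_i}(M^{(i)})$ of all subrepresentations $U\subseteq M$ with $\dim U^{(i)}=e_i$ for all $i$ (empty if some $e_i<0$). For a basis $B=\{b^{(i)}_k\}$ of $\bigoplus_{i} M^{(i)}$ consisting of bases of the $M^{(i)}$, the coefficient quiver $Q(M,B)$ has vertex set $B$ and an arrow $b^{(i)}_k\to b^{(j)}_\ell$ for each $(a:i\to j)\in Q_1$ such that the coefficient of $b^{(j)}_\ell$ in $M_ab^{(i)}_k$ is non-zero. $M$ is straight if for some $B$ every connected component of $Q(M,B)$ is an equioriented string $\bullet\to\cdots\to\bullet$ (possibly a single vertex); such $B$ is a straightening basis. Torus $T_M$: let $d$ be the number of connected components of $Q(M,B)$ and $c$ the number of arrows of the supporting subquiver $\mathrm{supp}\,M\subseteq Q$ (the vertices $i$ with $M^{(i)}\neq0$ and arrows $a$ with $M_a\ne0$).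 $T_M:=(\mathbb{C}^* )^{d+c}$, with elements $((\gamma_i)_{i\in[d]},(\nu_j)_{j\in[c]})$, acts on $\bigoplus_iM^{(i)}$ by scaling basis vectors: it scales the starting vertex of the $i$-th string by $\gamma_i$, and along each arrow of $Q(M,B)$ the scaling factor is multiplied by $\nu_j$, where $j$ is the label of the underlying arrow of $Q$. This induces an action on $\mathrm{Gr}_{\mathbf e}(M)$, $U\mapsto t.U$. *)

theory Defs
  imports
    "HOL-Analysis.Abstract_Topology"
    "HOL-Algebra.Product_Groups"
    "HOL-Algebra.Group_Action"
    "Graph_Theory.Graph_Theory"
begin

section \<open>Representations of a quiver\<close>

text \<open>
  A finite quiver is a \<^const>\<open>fin_digraph\<close> (loops and parallel arrows are allowed).  The spaces of a
  representation are complex subspaces of an arbitrary ambient complex vector space \<^typ>\<open>'m\<close>, with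
  scalar multiplication \<open>rep_scale\<close>; they may overlap, only the family matters.
  The maps are only relevant on the space at the tail of the arrow.
\<close>

record ('v, 'a, 'm) quiver_rep =
  rep_scale :: "complex \<Rightarrow> 'm \<Rightarrow> 'm"
  rep_space :: "'v \<Rightarrow> 'm set"
  rep_map :: "'a \<Rightarrow> 'm \<Rightarrow> 'm"

locale quiver_representation =
  fin_digraph Q + vector_space "rep_scale M"
  for Q :: "('v, 'a) pre_digraph" and M :: "('v, 'a, 'm::ab_group_add) quiver_rep" +
  assumes rep_subspace: "i \<in> verts Q \<Longrightarrow> subspace (rep_space M i)"
    and rep_finite_dim: "i \<in> verts Q \<Longrightarrow> \<exists>S. finite S \<and> span S = rep_space M i"
    and rep_map_closed:
      "a \<in> arcs Q \<Longrightarrow> x \<in> rep_space M (tail Q a) \<Longrightarrow> rep_map M a x \<in> rep_space M (head Q a)"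
    and rep_map_add:
      "a \<in> arcs Q \<Longrightarrow> x \<in> rep_space M (tail Q a) \<Longrightarrow> y \<in> rep_space M (tail Q a) \<Longrightarrow>
        rep_map M a (x + y) = rep_map M a x + rep_map M a y"
    and rep_map_scale:
      "a \<in> arcs Q \<Longrightarrow> x \<in> rep_space M (tail Q a) \<Longrightarrow>
        rep_map M a (rep_scale M c x) = rep_scale M c (rep_map M a x)"

definition rep_basis ::
  "('v, 'a) pre_digraph \<Rightarrow> ('v, 'a, 'm::ab_group_add) quiver_rep \<Rightarrow> ('v \<Rightarrow> 'm set) \<Rightarrow> bool" where
  "rep_basis Q M B \<longleftrightarrow>
    (\<forall>i\<in>verts Q. \<not> module.dependent (rep_scale M) (B i) \<and> module.span (rep_scale M) (B i) = rep_space M i)"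

text \<open>The set of arrows of the supporting subquiver.\<close>

definition supp_arcs ::
  "('v, 'a) pre_digraph \<Rightarrow> ('v, 'a, 'm::ab_group_add) quiver_rep \<Rightarrow> 'a set" where
  "supp_arcs Q M = {a \<in> arcs Q. \<exists>x \<in> rep_space M (tail Q a). rep_map M a x \<noteq> 0}"


section \<open>Coefficient quivers and straightening bases\<close>

text \<open>
  Vertices of the coefficient quiver are pairs \<open>(i, b)\<close> with \<open>b\<close> in the basis at \<open>i\<close>, so that equal
  vectors at different vertices of the quiver are kept apart.  An arrow \<open>(a, x, y)\<close> lies over \<open>a\<close>.
\<close>

definition coeff_quiver ::
  "('v, 'a) pre_digraph \<Rightarrow> ('v, 'a, 'm::ab_group_add) quiver_rep \<Rightarrow> ('v \<Rightarrow> 'm set)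
    \<Rightarrow> ('v \<times> 'm, 'a \<times> 'm \<times> 'm) pre_digraph" where
  "coeff_quiver Q M B =
    \<lparr> verts = (SIGMA i:verts Q. B i),
      arcs = {(a, x, y). a \<in> arcs Q \<and> x \<in> B (tail Q a) \<and> y \<in> B (head Q a) \<and>
        module.representation (rep_scale M) (B (head Q a)) (rep_map M a x) y \<noteq> 0},
      tail = (\<lambda>(a, x, y). (tail Q a, x)),
      head = (\<lambda>(a, x, y). (head Q a, y)) \<rparr>"

definition components :: "('a, 'b) pre_digraph \<Rightarrow> ('a, 'b) pre_digraph set" where
  "components G = {C. pre_digraph.max_subgraph G Digraph_Component.connected C}"

definition component_of :: "('a, 'b) pre_digraph \<Rightarrow> 'a \<Rightarrow> ('a, 'b) pre_digraph" where
  "component_of G v = (THE C. C \<in> components G \<and> v \<in> verts C)"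

text \<open>The equioriented string \<open>0 \<rightarrow> 1 \<rightarrow> \<dots> \<rightarrow> n\<close>.\<close>

definition equioriented_string :: "nat \<Rightarrow> (nat, nat) pre_digraph" where
  "equioriented_string n = \<lparr> verts = {..n}, arcs = {..<n}, tail = (\<lambda>k. k), head = Suc \<rparr>"

definition straightening_basis ::
  "('v, 'a) pre_digraph \<Rightarrow> ('v, 'a, 'm::ab_group_add) quiver_rep \<Rightarrow> ('v \<Rightarrow> 'm set) \<Rightarrow> bool" where
  "straightening_basis Q M B \<longleftrightarrow> rep_basis Q M B \<and>
    (\<forall>C \<in> components (coeff_quiver Q M B). \<exists>n. digraph_iso C (equioriented_string n))"

definition straight ::
  "('v, 'a) pre_digraph \<Rightarrow> ('v, 'a, 'm::ab_group_add) quiver_rep \<Rightarrow> bool" where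
  "straight Q M \<longleftrightarrow> (\<exists>B. straightening_basis Q M B)"


section \<open>Quiver Grassmannians and their Zariski topology\<close>

definition prod_grassmannian ::
  "('v, 'a) pre_digraph \<Rightarrow> ('v, 'a, 'm::ab_group_add) quiver_rep \<Rightarrow> ('v \<Rightarrow> int) \<Rightarrow> ('v \<Rightarrow> 'm set) set" where
  "prod_grassmannian Q M e =
    (\<Pi>\<^sub>E i\<in>verts Q. {U. module.subspace (rep_scale M) U \<and> U \<subseteq> rep_space M i \<and>
      int (vector_space.dim (rep_scale M) U) = e i})"

definition quiver_grassmannian ::
  "('v, 'a) pre_digraph \<Rightarrow> ('v, 'a, 'm::ab_group_add) quiver_rep \<Rightarrow> ('v \<Rightarrow> int) \<Rightarrow> ('v \<Rightarrow> 'm set) set" where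
  "quiver_grassmannian Q M e =
    {U \<in> prod_grassmannian Q M e. \<forall>a\<in>arcs Q. rep_map M a ` U (tail Q a) \<subseteq> U (head Q a)}"

text \<open>
  The Grassmannian of \<open>k\<close>-dimensional subspaces of \<open>V\<close> is the quotient of the variety of linearly
  independent \<open>k\<close>-tuples in \<open>V\<close> by \<open>GL\<^sub>k\<close>, and a set of subspaces is Zariski closed iff the set of all
  bases of its members is the zero locus of polynomials in the coordinates of the tuples.
  The polynomial functions are generated by linear functionals of the entries, so no choice of
  coordinates on the spaces is needed.
\<close>

definition frames ::
  "('v, 'a) pre_digraph \<Rightarrow> ('v, 'a, 'm::ab_group_add) quiver_rep \<Rightarrow> ('v \<Rightarrow> int) \<Rightarrow> ('v \<Rightarrow> 'm set)
    \<Rightarrow> ('v \<Rightarrow> nat \<Rightarrow> 'm) set" where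
  "frames Q M e U =
    {F \<in> (\<Pi>\<^sub>E i\<in>verts Q. {..<nat (e i)} \<rightarrow>\<^sub>E rep_space M i). \<forall>i\<in>verts Q.
      inj_on (F i) {..<nat (e i)} \<and>
      \<not> module.dependent (rep_scale M) (F i ` {..<nat (e i)}) \<and>
      module.span (rep_scale M) (F i ` {..<nat (e i)}) = U i}"

inductive_set frame_polys ::
  "('v, 'a) pre_digraph \<Rightarrow> ('v, 'a, 'm::ab_group_add) quiver_rep \<Rightarrow> ('v \<Rightarrow> int)
    \<Rightarrow> (('v \<Rightarrow> nat \<Rightarrow> 'm) \<Rightarrow> complex) set"
  for Q M e where
  const: "(\<lambda>F. c) \<in> frame_polys Q M e"
| coord: "i \<in> verts Q \<Longrightarrow> k < nat (e i) \<Longrightarrow> Vector_Spaces.linear (rep_scale M) (*) \<phi> \<Longrightarrow>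
    (\<lambda>F. \<phi> (F i k)) \<in> frame_polys Q M e"
| add: "p \<in> frame_polys Q M e \<Longrightarrow> q \<in> frame_polys Q M e \<Longrightarrow> (\<lambda>F. p F + q F) \<in> frame_polys Q M e"
| mult: "p \<in> frame_polys Q M e \<Longrightarrow> q \<in> frame_polys Q M e \<Longrightarrow> (\<lambda>F. p F * q F) \<in> frame_polys Q M e"

definition zariski_closed ::
  "('v, 'a) pre_digraph \<Rightarrow> ('v, 'a, 'm::ab_group_add) quiver_rep \<Rightarrow> ('v \<Rightarrow> int) \<Rightarrow> ('v \<Rightarrow> 'm set) set
    \<Rightarrow> bool" where
  "zariski_closed Q M e Z \<longleftrightarrow> Z \<subseteq> prod_grassmannian Q M e \<and>
    (\<exists>P \<subseteq> frame_polys Q M e. \<forall>U \<in> prod_grassmannian Q M e. \<forall>F \<in> frames Q M e U.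
      U \<in> Z \<longleftrightarrow> (\<forall>p\<in>P. p F = 0))"

definition prod_grassmannian_zariski ::
  "('v, 'a) pre_digraph \<Rightarrow> ('v, 'a, 'm::ab_group_add) quiver_rep \<Rightarrow> ('v \<Rightarrow> int) \<Rightarrow> ('v \<Rightarrow> 'm set) topology" where
  "prod_grassmannian_zariski Q M e =
    topology (\<lambda>W. W \<subseteq> prod_grassmannian Q M e \<and> zariski_closed Q M e (prod_grassmannian Q M e - W))"

definition quiver_grassmannian_zariski ::
  "('v, 'a) pre_digraph \<Rightarrow> ('v, 'a, 'm::ab_group_add) quiver_rep \<Rightarrow> ('v \<Rightarrow> int) \<Rightarrow> ('v \<Rightarrow> 'm set) topology" where
  "quiver_grassmannian_zariski Q M e =
    subtopology (prod_grassmannian_zariski Q M e) (quiver_grassmannian Q M e)"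

lemma zariski_closed_empty: "zariski_closed Q M e {}"
  unfolding zariski_closed_def
  by (auto intro!: exI[of _ "{\<lambda>F. 1}"] frame_polys.const)

lemma zariski_closed_all: "zariski_closed Q M e (prod_grassmannian Q M e)"
  unfolding zariski_closed_def by (auto intro!: exI[of _ "{}"])

lemma zariski_closed_Un:
  assumes "zariski_closed Q M e Y" "zariski_closed Q M e Z"
  shows "zariski_closed Q M e (Y \<union> Z)"
proof -
  let ?G = "prod_grassmannian Q M e"
  from assms(1) obtain P where Y: "Y \<subseteq> ?G" and P: "P \<subseteq> frame_polys Q M e"
    and YP: "\<forall>U \<in> ?G. \<forall>F \<in> frames Q M e U. U \<in> Y \<longleftrightarrow> (\<forall>p\<in>P. p F = 0)"
    unfolding zariski_closed_def by (elim conjE exE)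
  from assms(2) obtain R where Z: "Z \<subseteq> ?G" and R: "R \<subseteq> frame_polys Q M e"
    and ZR: "\<forall>U \<in> ?G. \<forall>F \<in> frames Q M e U. U \<in> Z \<longleftrightarrow> (\<forall>r\<in>R. r F = 0)"
    unfolding zariski_closed_def by (elim conjE exE)
  define S where "S = (\<lambda>(p, r) F. p F * r F) ` (P \<times> R)"
  have "S \<subseteq> frame_polys Q M e"
    unfolding S_def using P R by (auto intro!: frame_polys.mult)
  moreover have "U \<in> Y \<union> Z \<longleftrightarrow> (\<forall>s\<in>S. s F = 0)" if "U \<in> ?G" "F \<in> frames Q M e U" for U F
  proof -
    have "(\<forall>s\<in>S. s F = 0) \<longleftrightarrow> (\<forall>p\<in>P. \<forall>r\<in>R. p F = 0 \<or> r F = 0)"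
      unfolding S_def by simp
    also have "\<dots> \<longleftrightarrow> (\<forall>p\<in>P. p F = 0) \<or> (\<forall>r\<in>R. r F = 0)"
      by blast
    finally show ?thesis
      using YP[rule_format, OF that] ZR[rule_format, OF that] by simp
  qed
  ultimately show ?thesis
    unfolding zariski_closed_def using Y Z by (intro conjI exI[of _ S]) auto
qed

lemma zariski_closed_Inter:
  assumes "\<And>Z. Z \<in> \<Z> \<Longrightarrow> zariski_closed Q M e Z"
  shows "zariski_closed Q M e (prod_grassmannian Q M e \<inter> \<Inter>\<Z>)"
proof -
  let ?G = "prod_grassmannian Q M e"
  let ?cut = "\<lambda>Z P. P \<subseteq> frame_polys Q M e \<and>
    (\<forall>U \<in> ?G. \<forall>F \<in> frames Q M e U. U \<in> Z \<longleftrightarrow> (\<forall>p\<in>P. p F = 0))"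
  have "\<forall>Z\<in>\<Z>. \<exists>P. ?cut Z P"
    using assms unfolding zariski_closed_def by simp
  then obtain P where P: "\<forall>Z\<in>\<Z>. ?cut Z (P Z)"
    by (elim bchoice[elim_format] exE)
  have "U \<in> ?G \<inter> \<Inter>\<Z> \<longleftrightarrow> (\<forall>p \<in> (\<Union>Z\<in>\<Z>. P Z). p F = 0)"
    if "U \<in> ?G" "F \<in> frames Q M e U" for U F
  proof -
    have "U \<in> Z \<longleftrightarrow> (\<forall>p \<in> P Z. p F = 0)" if "Z \<in> \<Z>" for Z
      using P[rule_format, OF that] \<open>U \<in> ?G\<close> \<open>F \<in> frames Q M e U\<close> by simp
    then show ?thesis using \<open>U \<in> ?G\<close> by simp
  qed
  moreover have "(\<Union>Z\<in>\<Z>. P Z) \<subseteq> frame_polys Q M e"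
    using P by (simp add: UN_subset_iff)
  ultimately show ?thesis
    unfolding zariski_closed_def by (intro conjI exI[of _ "\<Union>Z\<in>\<Z>. P Z"] ballI) simp_all
qed

lemma istopology_prod_grassmannian_zariski:
  "istopology (\<lambda>W. W \<subseteq> prod_grassmannian Q M e \<and>
    zariski_closed Q M e (prod_grassmannian Q M e - W))"
  unfolding istopology_def
proof (intro conjI allI impI)
  fix S T
  assume S: "S \<subseteq> prod_grassmannian Q M e \<and> zariski_closed Q M e (prod_grassmannian Q M e - S)"
    and T: "T \<subseteq> prod_grassmannian Q M e \<and> zariski_closed Q M e (prod_grassmannian Q M e - T)"
  show "S \<inter> T \<subseteq> prod_grassmannian Q M e" using S by blast
  show "zariski_closed Q M e (prod_grassmannian Q M e - S \<inter> T)"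
    using zariski_closed_Un[of Q M e "prod_grassmannian Q M e - S" "prod_grassmannian Q M e - T"] S T
    by (simp add: Diff_Int)
next
  fix \<K>
  assume K: "\<forall>K\<in>\<K>. K \<subseteq> prod_grassmannian Q M e \<and>
    zariski_closed Q M e (prod_grassmannian Q M e - K)"
  show "\<Union>\<K> \<subseteq> prod_grassmannian Q M e" using K by blast
  have eq: "prod_grassmannian Q M e - \<Union>\<K> =
      prod_grassmannian Q M e \<inter> \<Inter>((\<lambda>K. prod_grassmannian Q M e - K) ` \<K>)"
    by auto
  show "zariski_closed Q M e (prod_grassmannian Q M e - \<Union>\<K>)"
    unfolding eq by (rule zariski_closed_Inter) (use K in blast)
qed

lemma openin_prod_grassmannian_zariski:
  "openin (prod_grassmannian_zariski Q M e) W \<longleftrightarrow>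
    W \<subseteq> prod_grassmannian Q M e \<and> zariski_closed Q M e (prod_grassmannian Q M e - W)"
  unfolding prod_grassmannian_zariski_def
  by (rule fun_cong[OF topology_inverse'[OF istopology_prod_grassmannian_zariski]])

lemma topspace_prod_grassmannian_zariski:
  "topspace (prod_grassmannian_zariski Q M e) = prod_grassmannian Q M e"
  unfolding topspace_def openin_prod_grassmannian_zariski
  using zariski_closed_empty[of Q M e] by auto

lemma closedin_prod_grassmannian_zariski:
  "closedin (prod_grassmannian_zariski Q M e) Z \<longleftrightarrow> zariski_closed Q M e Z"
  unfolding closedin_def topspace_prod_grassmannian_zariski openin_prod_grassmannian_zariski
  by (metis Diff_subset double_diff subset_refl zariski_closed_def)


section \<open>Krull dimension\<close>

definition irreducible_in :: "'a topology \<Rightarrow> 'a set \<Rightarrow> bool" where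
  "irreducible_in X S \<longleftrightarrow> S \<subseteq> topspace X \<and> S \<noteq> {} \<and>
    (\<forall>Y Z. closedin X Y \<longrightarrow> closedin X Z \<longrightarrow> S \<subseteq> Y \<union> Z \<longrightarrow> S \<subseteq> Y \<or> S \<subseteq> Z)"

text \<open>The value on the empty space is \<open>0\<close>; only nonempty spaces (orbits) are considered below.\<close>

definition krull_dim :: "'a topology \<Rightarrow> enat" where
  "krull_dim X = Sup {enat n | n. \<exists>Z :: nat \<Rightarrow> 'a set.
    (\<forall>k\<le>n. closedin X (Z k) \<and> irreducible_in X (Z k)) \<and> (\<forall>k<n. Z k \<subset> Z (Suc k))}"


section \<open>The torus and its action\<close>

definition complex_units :: "complex monoid" where
  "complex_units = \<lparr> carrier = - {0}, monoid.mult = (*), one = 1 \<rparr>"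

text \<open>
  The coordinates of the torus are indexed by the components of the coefficient quiver and by the
  arrows of the supporting subquiver themselves instead of by an enumeration of them.
\<close>

definition rep_torus ::
  "('v, 'a) pre_digraph \<Rightarrow> ('v, 'a, 'm::ab_group_add) quiver_rep \<Rightarrow> ('v \<Rightarrow> 'm set)
    \<Rightarrow> ((('v \<times> 'm, 'a \<times> 'm \<times> 'm) pre_digraph \<Rightarrow> complex) \<times> ('a \<Rightarrow> complex)) monoid" where
  "rep_torus Q M B =
    product_group (components (coeff_quiver Q M B)) (\<lambda>_. complex_units) \<times>\<times>
    product_group (supp_arcs Q M) (\<lambda>_. complex_units)"

text \<open>
  In a string, the arrows whose head reaches \<open>v\<close> are exactly those on the path from the starting
  vertex of the string to \<open>v\<close>.  See \<open>torus_weight_start\<close> and \<open>torus_weight_step\<close> below.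
\<close>

definition torus_weight ::
  "('v, 'a) pre_digraph \<Rightarrow> ('v, 'a, 'm::ab_group_add) quiver_rep \<Rightarrow> ('v \<Rightarrow> 'm set)
    \<Rightarrow> (('v \<times> 'm, 'a \<times> 'm \<times> 'm) pre_digraph \<Rightarrow> complex) \<times> ('a \<Rightarrow> complex) \<Rightarrow> 'v \<times> 'm \<Rightarrow> complex" where
  "torus_weight Q M B t v = (let G = coeff_quiver Q M B in
    fst t (component_of G v) * (\<Prod>\<alpha> | \<alpha> \<in> arcs G \<and> head G \<alpha> \<rightarrow>\<^sup>*\<^bsub>G\<^esub> v. snd t (fst \<alpha>)))"

definition torus_map ::
  "('v, 'a) pre_digraph \<Rightarrow> ('v, 'a, 'm::ab_group_add) quiver_rep \<Rightarrow> ('v \<Rightarrow> 'm set)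
    \<Rightarrow> (('v \<times> 'm, 'a \<times> 'm \<times> 'm) pre_digraph \<Rightarrow> complex) \<times> ('a \<Rightarrow> complex) \<Rightarrow> 'v \<Rightarrow> 'm \<Rightarrow> 'm" where
  "torus_map Q M B t i x =
    (\<Sum>b\<in>B i. rep_scale M
      (torus_weight Q M B t (i, b) * module.representation (rep_scale M) (B i) x b) b)"

definition torus_action ::
  "('v, 'a) pre_digraph \<Rightarrow> ('v, 'a, 'm::ab_group_add) quiver_rep \<Rightarrow> ('v \<Rightarrow> 'm set) \<Rightarrow> ('v \<Rightarrow> int)
    \<Rightarrow> (('v \<times> 'm, 'a \<times> 'm \<times> 'm) pre_digraph \<Rightarrow> complex) \<times> ('a \<Rightarrow> complex)
    \<Rightarrow> ('v \<Rightarrow> 'm set) \<Rightarrow> ('v \<Rightarrow> 'm set)" where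
  "torus_action Q M B e t =
    (\<lambda>U \<in> quiver_grassmannian Q M e. \<lambda>i \<in> verts Q. torus_map Q M B t i ` U i)"


section \<open>The weights scale along the strings as intended\<close>

context wf_digraph
begin

definition linked :: "'a \<Rightarrow> 'a set" where
  "linked v = {w. v \<rightarrow>\<^sup>*\<^bsub>mk_symmetric G\<^esub> w}"

lemma linked_subset: "linked v \<subseteq> verts G"
  unfolding linked_def by (auto elim!: reachable_in_vertsE)

lemma connected_subgraph_le:
  assumes "subgraph C G" "Digraph_Component.connected C" "v \<in> verts C"
  shows "subgraph C (G \<restriction> linked v)"
proof -
  interpret S: pair_wf_digraph "mk_symmetric G" by (rule wellformed_mk_symmetric)
  interpret C: wf_digraph C using assms(1) by (simp add: subgraph_def)
  have "w \<in> linked v" if "w \<in> verts C" for w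
  proof -
    have "v \<rightarrow>\<^sup>*\<^bsub>mk_symmetric C\<^esub> w"
      using assms(2,3) that unfolding Digraph_Component.connected_def strongly_connected_def by simp
    then show ?thesis
      unfolding linked_def
      using pre_digraph.reachable_mono[OF _ subgraph_mk_symmetric[OF assms(1)]] by simp
  qed
  then show ?thesis
    using assms(1) C.tail_in_verts C.head_in_verts
    by (auto simp: subgraph_def compatible_def wellformed_induce_subgraph)
qed

lemma connected_linked:
  assumes "v \<in> verts G"
  shows "Digraph_Component.connected (G \<restriction> linked v)"
proof -
  interpret S: pair_wf_digraph "mk_symmetric G" by (rule wellformed_mk_symmetric)
  interpret I: wf_digraph "G \<restriction> linked v" by (rule wellformed_induce_subgraph)
  interpret IS: pair_wf_digraph "mk_symmetric (G \<restriction> linked v)" by (rule I.wellformed_mk_symmetric)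
  have v: "v \<in> linked v" unfolding linked_def using assms by simp
  have to: "v \<rightarrow>\<^sup>*\<^bsub>mk_symmetric (G \<restriction> linked v)\<^esub> w" if "v \<rightarrow>\<^sup>*\<^bsub>mk_symmetric G\<^esub> w" for w
    using that
  proof (induction rule: S.reachable_induct)
    case base
    show ?case by (rule IS.reachable_refl) (simp add: v)
  next
    case (step x y)
    have "x \<in> linked v" using step unfolding linked_def by simp
    moreover have "y \<in> linked v"
      unfolding linked_def using step S.reachable_adj_trans by blast
    ultimately have "x \<rightarrow>\<^bsub>mk_symmetric (G \<restriction> linked v)\<^esub> y"
      using step(2) by (auto simp: parcs_mk_symmetric)
    then show ?case using IS.reachable_adj_trans[OF step(3)] by simp
  qed
  have sym: "symmetric (with_proj (mk_symmetric (G \<restriction> linked v)))"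
    by (rule symmetric_mk_symmetric)
  show ?thesis
  proof (rule I.connectedI)
    show "verts (G \<restriction> linked v) \<noteq> {}" using v by auto
    fix x y assume "x \<in> verts (G \<restriction> linked v)" "y \<in> verts (G \<restriction> linked v)"
    then have "v \<rightarrow>\<^sup>*\<^bsub>mk_symmetric (G \<restriction> linked v)\<^esub> x" "v \<rightarrow>\<^sup>*\<^bsub>mk_symmetric (G \<restriction> linked v)\<^esub> y"
      using to by (auto simp: linked_def)
    then show "x \<rightarrow>\<^sup>*\<^bsub>mk_symmetric (G \<restriction> linked v)\<^esub> y"
      using symmetric_reachable[OF sym] IS.reachable_trans by blast
  qed
qed

lemma subgraph_linked: "subgraph (G \<restriction> linked v) G"
  using linked_subset wellformed_induce_subgraph wf_digraph
  by (auto simp: subgraph_def compatible_def)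

lemma subgraph_antisym:
  assumes "subgraph C D" "subgraph D C"
  shows "C = D"
  using assms by (auto simp: subgraph_def compatible_def)

lemma linked_in_components:
  assumes "v \<in> verts G"
  shows "G \<restriction> linked v \<in> components G"
proof -
  have v: "v \<in> linked v" unfolding linked_def
  proof -
    interpret S: pair_wf_digraph "mk_symmetric G" by (rule wellformed_mk_symmetric)
    show "v \<in> {w. v \<rightarrow>\<^sup>*\<^bsub>mk_symmetric G\<^esub> w}" using assms by simp
  qed
  have "H = G \<restriction> linked v"
    if "subgraph (G \<restriction> linked v) H" "subgraph H G" "Digraph_Component.connected H" for H
  proof -
    have "v \<in> verts H" using that(1) v by (auto simp: subgraph_def)
    from subgraph_antisym[OF connected_subgraph_le[OF that(2,3) this] that(1)] show ?thesis .
  qed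
  then show ?thesis
    unfolding components_def max_subgraph_def using subgraph_linked connected_linked[OF assms]
    by blast
qed

lemma component_eq_linked:
  assumes "C \<in> components G" "v \<in> verts C"
  shows "C = G \<restriction> linked v"
proof -
  have C: "subgraph C G" "Digraph_Component.connected C" and m: "max_subgraph Digraph_Component.connected C"
    using assms(1) unfolding components_def max_subgraph_def by auto
  have "v \<in> verts G" using C(1) assms(2) by (auto simp: subgraph_def)
  then have "max_subgraph Digraph_Component.connected (G \<restriction> linked v)"
    using linked_in_components unfolding components_def by simp
  from max_subgraph_subg_eq[OF m this connected_subgraph_le[OF C assms(2)]] show ?thesis .
qed

lemma component_of_eq:
  assumes "v \<in> verts G"
  shows "component_of G v = G \<restriction> linked v"
proof -
  interpret S: pair_wf_digraph "mk_symmetric G" by (rule wellformed_mk_symmetric)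
  have "v \<in> linked v" unfolding linked_def using assms by simp
  then show ?thesis
    unfolding component_of_def
    by (intro the_equality conjI linked_in_components[OF assms])
      (simp, elim conjE, rule component_eq_linked)
qed

lemma component_of_in:
  assumes "v \<in> verts G"
  shows "component_of G v \<in> components G" "v \<in> verts (component_of G v)"
proof -
  interpret S: pair_wf_digraph "mk_symmetric G" by (rule wellformed_mk_symmetric)
  show "component_of G v \<in> components G" "v \<in> verts (component_of G v)"
    using linked_in_components[OF assms] assms by (auto simp: component_of_eq linked_def)
qed

lemma component_of_arc:
  assumes "\<alpha> \<in> arcs G"
  shows "component_of G (tail G \<alpha>) = component_of G (head G \<alpha>)"
    and "\<alpha> \<in> arcs (component_of G (head G \<alpha>))"
proof -
  interpret S: pair_wf_digraph "mk_symmetric G" by (rule wellformed_mk_symmetric)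
  have "head G \<alpha> \<rightarrow>\<^bsub>mk_symmetric G\<^esub> tail G \<alpha>"
    using assms by (auto simp: parcs_mk_symmetric)
  then have t: "tail G \<alpha> \<in> linked (head G \<alpha>)" unfolding linked_def by auto
  have h: "head G \<alpha> \<in> linked (head G \<alpha>)" unfolding linked_def using assms by simp
  have "component_of G (head G \<alpha>) = G \<restriction> linked (tail G \<alpha>)"
    using component_eq_linked[OF component_of_in(1), of "head G \<alpha>" "tail G \<alpha>"] t assms
    by (simp add: component_of_eq)
  then show "component_of G (tail G \<alpha>) = component_of G (head G \<alpha>)"
    using assms by (simp add: component_of_eq)
  show "\<alpha> \<in> arcs (component_of G (head G \<alpha>))"
    using assms t h by (simp add: component_of_eq)
qed

lemma string_components:
  assumes "\<forall>C \<in> components G. \<exists>n. digraph_iso C (equioriented_string n)"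
    and "v \<in> verts G"
  obtains f where "\<And>\<alpha>. \<alpha> \<in> arcs (component_of G v) \<Longrightarrow> f (head G \<alpha>) = Suc (f (tail G \<alpha>))"
    and "\<And>\<alpha> \<beta>. \<alpha> \<in> arcs (component_of G v) \<Longrightarrow> \<beta> \<in> arcs (component_of G v) \<Longrightarrow>
      head G \<alpha> = head G \<beta> \<Longrightarrow> \<alpha> = \<beta>"
proof -
  let ?C = "component_of G v"
  obtain n h where h: "pre_digraph.digraph_isomorphism ?C h" "equioriented_string n = app_iso h ?C"
    using assms component_of_in(1) unfolding digraph_iso_def by blast
  have C: "tail ?C = tail G" "head ?C = head G"
    using assms(2) by (simp_all add: component_of_eq)
  have ht: "iso_tail h = (\<lambda>k. k)" "iso_head h = Suc"
    using h(2) unfolding equioriented_string_def app_iso_def by simp_all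
  have t: "iso_verts h (tail G \<alpha>) = iso_arcs h \<alpha>" if "\<alpha> \<in> arcs ?C" for \<alpha>
    using h(1) that unfolding pre_digraph.digraph_isomorphism_def ht C by simp
  have d: "iso_verts h (head G \<alpha>) = Suc (iso_arcs h \<alpha>)" if "\<alpha> \<in> arcs ?C" for \<alpha>
    using h(1) that unfolding pre_digraph.digraph_isomorphism_def ht C by simp
  have inj: "inj_on (iso_arcs h) (arcs ?C)"
    using h(1) unfolding pre_digraph.digraph_isomorphism_def by simp
  show ?thesis
  proof (rule that[of "iso_verts h"])
    show "iso_verts h (head G \<alpha>) = Suc (iso_verts h (tail G \<alpha>))" if "\<alpha> \<in> arcs ?C" for \<alpha>
      using t[OF that] d[OF that] by simp
    show "\<alpha> = \<beta>" if "\<alpha> \<in> arcs ?C" "\<beta> \<in> arcs ?C" "head G \<alpha> = head G \<beta>" for \<alpha> \<beta>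
      using d[OF that(1)] d[OF that(2)] that inj by (simp add: inj_on_def)
  qed
qed

lemma string_predecessors:
  assumes strings: "\<forall>C \<in> components G. \<exists>n. digraph_iso C (equioriented_string n)"
    and \<alpha>: "\<alpha> \<in> arcs G"
  shows "{\<beta> \<in> arcs G. head G \<beta> \<rightarrow>\<^sup>*\<^bsub>G\<^esub> head G \<alpha>} =
      insert \<alpha> {\<beta> \<in> arcs G. head G \<beta> \<rightarrow>\<^sup>*\<^bsub>G\<^esub> tail G \<alpha>}"
    and "\<not> head G \<alpha> \<rightarrow>\<^sup>*\<^bsub>G\<^esub> tail G \<alpha>"
proof -
  let ?v = "head G \<alpha>"
  obtain f where f: "\<And>\<beta>. \<beta> \<in> arcs (component_of G ?v) \<Longrightarrow> f (head G \<beta>) = Suc (f (tail G \<beta>))"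
    and inj: "\<And>\<beta> \<gamma>. \<beta> \<in> arcs (component_of G ?v) \<Longrightarrow> \<gamma> \<in> arcs (component_of G ?v) \<Longrightarrow>
      head G \<beta> = head G \<gamma> \<Longrightarrow> \<beta> = \<gamma>"
    using string_components[OF strings, of ?v] \<alpha> by auto
  have uniq: "\<beta> = \<alpha>" if "\<beta> \<in> arcs G" "head G \<beta> = ?v" for \<beta>
    using inj[of \<beta> \<alpha>] component_of_arc(2)[OF \<alpha>] component_of_arc(2)[OF that(1)] that by simp
  have bwd: "w = ?v \<or> w \<rightarrow>\<^sup>*\<^bsub>G\<^esub> tail G \<alpha>" if w: "w \<rightarrow>\<^sup>*\<^bsub>G\<^esub> ?v" for w
    using w
  proof (induction rule: converse_reachable_induct)
    case base
    then show ?case by simp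
  next
    case (step x y)
    from step(1) obtain \<beta> where \<beta>: "\<beta> \<in> arcs G" "tail G \<beta> = x" "head G \<beta> = y"
      by (rule reachableE)
    show ?case
    proof (cases "y = ?v")
      case True
      then have "x = tail G \<alpha>" using uniq \<beta> by auto
      then show ?thesis using \<alpha> by simp
    next
      case False
      then show ?thesis using step adj_reachable_trans by blast
    qed
  qed
  have fwd: "w \<rightarrow>\<^sup>*\<^bsub>G\<^esub> ?v" if "w \<rightarrow>\<^sup>*\<^bsub>G\<^esub> tail G \<alpha>" for w
  proof -
    have "tail G \<alpha> \<rightarrow>\<^bsub>G\<^esub> ?v" using \<alpha> by (auto simp: arcs_ends_conv)
    with that show ?thesis by (rule reachable_adj_trans)
  qed
  show "{\<beta> \<in> arcs G. head G \<beta> \<rightarrow>\<^sup>*\<^bsub>G\<^esub> head G \<alpha>} =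
      insert \<alpha> {\<beta> \<in> arcs G. head G \<beta> \<rightarrow>\<^sup>*\<^bsub>G\<^esub> tail G \<alpha>}"
    using bwd fwd uniq \<alpha> by auto
  have mono: "component_of G w = component_of G ?v \<and> f ?v \<le> f w" if "?v \<rightarrow>\<^sup>*\<^bsub>G\<^esub> w" for w
    using that
  proof (induction rule: reachable_induct)
    case base
    then show ?case by simp
  next
    case (step x y)
    from step(2) obtain \<beta> where \<beta>: "\<beta> \<in> arcs G" "tail G \<beta> = x" "head G \<beta> = y"
      by (rule reachableE)
    then show ?case using component_of_arc[OF \<beta>(1)] step(3) f[of \<beta>] by auto
  qed
  show "\<not> head G \<alpha> \<rightarrow>\<^sup>*\<^bsub>G\<^esub> tail G \<alpha>"
    using mono[of "tail G \<alpha>"] f[OF component_of_arc(2)[OF \<alpha>]] by auto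
qed

end

lemma (in quiver_representation) fin_digraph_coeff_quiver:
  assumes "rep_basis Q M B"
  shows "fin_digraph (coeff_quiver Q M B)"
proof -
  have fin: "finite (B i)" if i: "i \<in> verts Q" for i
  proof -
    obtain S where S: "finite S" "span S = rep_space M i" using rep_finite_dim[OF i] by blast
    have "independent (B i)" "span (B i) = rep_space M i"
      using assms i unfolding rep_basis_def by auto
    then show ?thesis
      using independent_span_bound[OF S(1), of "B i"] span_superset[of "B i"] S(2) by auto
  qed
  have "arcs (coeff_quiver Q M B) \<subseteq> (SIGMA a:arcs Q. B (tail Q a) \<times> B (head Q a))"
    unfolding coeff_quiver_def by auto
  moreover have "finite (SIGMA a:arcs Q. B (tail Q a) \<times> B (head Q a))"
    using fin by (intro finite_SigmaI finite_cartesian_product) auto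
  ultimately have "finite (arcs (coeff_quiver Q M B))" by (rule finite_subset)
  moreover have "finite (verts (coeff_quiver Q M B))"
    unfolding coeff_quiver_def using fin by (simp add: finite_SigmaI)
  moreover have "wf_digraph (coeff_quiver Q M B)"
    unfolding coeff_quiver_def by unfold_locales auto
  ultimately show ?thesis by (simp add: fin_digraph_def fin_digraph_axioms_def)
qed

lemma (in quiver_representation) torus_weight_start:
  assumes "straightening_basis Q M B" "v \<in> verts (coeff_quiver Q M B)"
    and "\<And>\<alpha>. \<alpha> \<in> arcs (coeff_quiver Q M B) \<Longrightarrow> head (coeff_quiver Q M B) \<alpha> \<noteq> v"
  shows "torus_weight Q M B t v = fst t (component_of (coeff_quiver Q M B) v)"
proof -
  let ?G = "coeff_quiver Q M B"
  interpret G: fin_digraph ?G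
    using assms(1) fin_digraph_coeff_quiver unfolding straightening_basis_def by blast
  have "\<not> head ?G \<alpha> \<rightarrow>\<^sup>*\<^bsub>?G\<^esub> v" if \<alpha>: "\<alpha> \<in> arcs ?G" for \<alpha>
  proof
    assume "head ?G \<alpha> \<rightarrow>\<^sup>*\<^bsub>?G\<^esub> v"
    then have "\<exists>\<beta>\<in>arcs ?G. head ?G \<beta> = v"
    proof (induction rule: G.reachable_induct)
      case base
      show ?case using \<alpha> by blast
    next
      case (step x y)
      from step(2) show ?case by (rule reachableE) blast
    qed
    then show False using assms(3) by blast
  qed
  then have "{\<alpha> \<in> arcs ?G. head ?G \<alpha> \<rightarrow>\<^sup>*\<^bsub>?G\<^esub> v} = {}" by blast
  then show ?thesis unfolding torus_weight_def Let_def by (simp only: prod.empty mult_1_right)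
qed

lemma (in quiver_representation) torus_weight_step:
  assumes "straightening_basis Q M B" "\<alpha> \<in> arcs (coeff_quiver Q M B)"
  shows "torus_weight Q M B t (head (coeff_quiver Q M B) \<alpha>) =
    torus_weight Q M B t (tail (coeff_quiver Q M B) \<alpha>) * snd t (fst \<alpha>)"
proof -
  let ?G = "coeff_quiver Q M B"
  interpret G: fin_digraph ?G
    using assms(1) fin_digraph_coeff_quiver unfolding straightening_basis_def by blast
  have strings: "\<forall>C \<in> components ?G. \<exists>n. digraph_iso C (equioriented_string n)"
    using assms(1) unfolding straightening_basis_def by blast
  show ?thesis
    unfolding torus_weight_def Let_def G.string_predecessors(1)[OF strings assms(2)]
    using G.component_of_arc(1)[OF assms(2)] G.string_predecessors(2)[OF strings assms(2)]
    by (simp add: mult.commute mult.left_commute)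
qed

end

theory Submission
  imports Defs "Jordan_Normal_Form.Determinant"
begin

text \<open>
  In reduced echelon form with respect to \<open>B\<close>, a subspace at a vertex is spanned by rows
  \<open>p + \<Sum> c\<^sub>p\<^sub>q q\<close>, and a torus element multiplies \<open>c\<^sub>p\<^sub>q\<close> by the ratio of the weights of \<open>q\<close> and \<open>p\<close>.
  Fixing the value of one \<open>c\<^sub>p\<^sub>q\<close> is a Zariski closed condition.  So if a one-parameter subgroup fixes
  one nonzero entry but moves another, the chain point, orbit of the subgroup, whole orbit shows that
  the orbit does not have dimension one.  In a one-dimensional orbit all nonzero entries therefore
  have the same weight ratio up to inversion.

  The part of a subrepresentation supported in a single string is spanned by basis vectors, since a
  string is uniserial; hence some nonzero entry, if there is any, joins two different strings, and then
  all of them join the same two strings with the same shift.  Transporting a vector \<open>p + c q\<close> along the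
  two strings in parallel expresses every nonzero entry by a single one, which the torus scales
  arbitrarily.  So the positions of the pivots and of the nonzero entries determine the orbit, and
  these are finite in number.
\<close>

section \<open>Walks in strings\<close>

context wf_digraph
begin

text \<open>No orbit dimension is computed. What is shown is only that certain orbits carry a chain
  of three irreducible closed sets, so that their Krull dimension is not one. Such a chain needs two
  separating closed conditions: an entry that the subgroup moves separates the point from the middle
  set, and the entry that the subgroup fixes must still be moved by the full torus. That is why the
  fixed entry has to join two different strings: scaling one string alone then moves it. An entry
  within one string, possible when a string returns to a vertex along a cycle of \<open>Q\<close>,
  is moved by the arrow coordinates alone.

  Pivots are chosen without any order, so either of the two strings may carry the pivot; hence the
  inversion. Irreducibility comes from curves: one-parameter subgroups with natural exponents, and
  lines in the coordinates of the torus, are polynomial, and a nonzero polynomial in one variable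
  has only finitely many zeros.\<close>

lemma string_out_unique:
  assumes strings: "\<forall>C \<in> components G. \<exists>n. digraph_iso C (equioriented_string n)"
    and \<alpha>: "\<alpha> \<in> arcs G" and \<beta>: "\<beta> \<in> arcs G" and eq: "tail G \<alpha> = tail G \<beta>"
  shows "\<alpha> = \<beta>"
proof -
  let ?C = "component_of G (head G \<alpha>)"
  have "?C \<in> components G"
    using component_of_in(1) \<alpha> by simp
  then obtain n h where h: "pre_digraph.digraph_isomorphism ?C h" "equioriented_string n = app_iso h ?C"
    using strings unfolding digraph_iso_def by blast
  have C: "tail ?C = tail G" using \<alpha> by (simp add: component_of_eq)
  have ht: "iso_tail h = (\<lambda>k. k)"
    using h(2) unfolding equioriented_string_def app_iso_def by simp
  \<comment> \<open>In the model string an arc is its own tail, so the label of an arc can be read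
    off from its tail.\<close>
  have t: "iso_verts h (tail G \<gamma>) = iso_arcs h \<gamma>" if "\<gamma> \<in> arcs ?C" for \<gamma>
    using h(1) that unfolding pre_digraph.digraph_isomorphism_def ht C by simp
  have inj: "inj_on (iso_arcs h) (arcs ?C)"
    using h(1) unfolding pre_digraph.digraph_isomorphism_def by simp
  have "\<alpha> \<in> arcs ?C" using component_of_arc(2)[OF \<alpha>] .
  moreover have "\<beta> \<in> arcs ?C"
    using component_of_arc[OF \<beta>] component_of_arc(1)[OF \<alpha>] eq by simp
  ultimately show ?thesis
    using t inj eq by (metis inj_onD)
qed

text \<open>The isomorphism numbers the vertices of a component from 0 to \<open>n\<close>, and
  every number below \<open>n\<close> is the label of an arc to the next vertex. Following these
  arcs leads from the smaller to the larger number; which of \<open>v\<close> and \<open>w\<close>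
  comes first is left open.\<close>

lemma string_walk:
  assumes strings: "\<forall>C \<in> components G. \<exists>n. digraph_iso C (equioriented_string n)"
    and v: "v \<in> verts G" and w: "w \<in> verts G" and eq: "component_of G v = component_of G w"
  shows "\<exists>k. (v, w) \<in> arcs_ends G ^^ k \<or> (w, v) \<in> arcs_ends G ^^ k"
proof -
  let ?C = "component_of G v"
  obtain n h where h: "pre_digraph.digraph_isomorphism ?C h" "equioriented_string n = app_iso h ?C"
    using strings component_of_in(1)[OF v] unfolding digraph_iso_def by blast
  have C: "tail ?C = tail G" "head ?C = head G" "arcs ?C \<subseteq> arcs G"
    using v by (auto simp: component_of_eq)
  have ht: "iso_tail h = (\<lambda>k. k)" "iso_head h = Suc"
      "iso_verts h ` verts ?C = {..n}" "iso_arcs h ` arcs ?C = {..<n}"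
    using h(2) unfolding equioriented_string_def app_iso_def by simp_all
  have inj: "inj_on (iso_verts h) (verts ?C)"
    using h(1) unfolding pre_digraph.digraph_isomorphism_def by simp
  have wf: "wf_digraph ?C"
    using h(1) unfolding pre_digraph.digraph_isomorphism_def by simp
  have t: "iso_verts h (tail G \<gamma>) = iso_arcs h \<gamma>" "iso_verts h (head G \<gamma>) = Suc (iso_arcs h \<gamma>)"
    if "\<gamma> \<in> arcs ?C" for \<gamma>
    using h(1) that unfolding pre_digraph.digraph_isomorphism_def ht C by simp_all
  have walk: "(x, y) \<in> arcs_ends G ^^ k"
    if "x \<in> verts ?C" "y \<in> verts ?C" "iso_verts h y = iso_verts h x + k" for x y k
    using that
  proof (induction k arbitrary: x)
    case 0
    then show ?case using inj by (simp add: inj_onD)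
  next
    case (Suc k)
    have "iso_verts h y \<le> n" using Suc.prems(2) ht(3) by blast
    then have "iso_verts h x \<in> {..<n}" using Suc.prems(3) by simp
    then obtain \<gamma> where \<gamma>: "\<gamma> \<in> arcs ?C" "iso_arcs h \<gamma> = iso_verts h x"
      using ht(4) by (metis imageE)
    have "tail G \<gamma> \<in> verts ?C" "head G \<gamma> \<in> verts ?C"
      using wf_digraph.tail_in_verts[OF wf \<gamma>(1)] wf_digraph.head_in_verts[OF wf \<gamma>(1)] C by simp_all
    moreover from this have "tail G \<gamma> = x"
      using t(1)[OF \<gamma>(1)] \<gamma>(2) Suc.prems(1) inj by (metis inj_onD)
    ultimately have "(x, head G \<gamma>) \<in> arcs_ends G" "(head G \<gamma>, y) \<in> arcs_ends G ^^ k"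
      using \<gamma> C(3) Suc t(2)[OF \<gamma>(1)] by (auto simp: arcs_ends_conv)
    then show ?case by (rule relpow_Suc_I2)
  qed
  have vw: "v \<in> verts ?C" "w \<in> verts ?C"
    using component_of_in(2)[OF v] component_of_in(2)[OF w] eq by simp_all
  show ?thesis
    using walk[OF vw] walk[OF vw(2,1)] by (metis nat_le_linear le_iff_add)
qed

lemma component_eqE:
  assumes "C \<in> components G"
  obtains v where "v \<in> verts G" "C = component_of G v"
proof -
  from assms have C: "subgraph C G" "Digraph_Component.connected C"
    unfolding components_def max_subgraph_def by auto
  then have "verts C \<noteq> {}"
    unfolding Digraph_Component.connected_def strongly_connected_def by auto
  then obtain v where v: "v \<in> verts C" by blast
  with C have "v \<in> verts G" by (auto simp: subgraph_def)
  with that component_eq_linked[OF assms v] show ?thesis by (simp add: component_of_eq)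
qed

end

section \<open>Positions in the coefficient quiver and the arrow maps on basis vectors\<close>

locale straight_rep = quiver_representation Q M
  for Q :: "('v, 'a) pre_digraph" and M :: "('v, 'a, 'm::ab_group_add) quiver_rep" +
  fixes B :: "'v \<Rightarrow> 'm set"
  assumes straightening: "straightening_basis Q M B"
begin

abbreviation CQ :: "('v \<times> 'm, 'a \<times> 'm \<times> 'm) pre_digraph" where
  "CQ \<equiv> coeff_quiver Q M B"

abbreviation scaleM (infixr "*\<^sub>M" 75) where "scaleM \<equiv> rep_scale M"

abbreviation string_of :: "'v \<times> 'm \<Rightarrow> ('v \<times> 'm, 'a \<times> 'm \<times> 'm) pre_digraph" where
  "string_of \<equiv> component_of CQ"

abbreviation coord :: "'v \<Rightarrow> 'm \<Rightarrow> 'm \<Rightarrow> complex" where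
  "coord i \<equiv> representation (B i)"

text \<open>The position of \<open>v\<close> in its string, starting from 0. The arcs counted are
  those in the product of \<open>torus_weight\<close>, so setting all arrow coordinates to one value
  turns that product into a power with exponent \<open>height v\<close>.\<close>

definition height :: "'v \<times> 'm \<Rightarrow> nat" where
  "height v = card {\<alpha> \<in> arcs CQ. head CQ \<alpha> \<rightarrow>\<^sup>*\<^bsub>CQ\<^esub> v}"

lemma rep_basis: "rep_basis Q M B"
  using straightening unfolding straightening_basis_def by blast

lemma strings: "\<forall>C \<in> components CQ. \<exists>n. digraph_iso C (equioriented_string n)"
  using straightening unfolding straightening_basis_def by blast

lemma independent_B: "i \<in> verts Q \<Longrightarrow> independent (B i)"
  and span_B: "i \<in> verts Q \<Longrightarrow> span (B i) = rep_space M i"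
  using rep_basis unfolding rep_basis_def by auto

sublocale CQ: fin_digraph "coeff_quiver Q M B"
  by (rule fin_digraph_coeff_quiver[OF rep_basis])

lemma verts_CQ: "verts CQ = (SIGMA i:verts Q. B i)"
  by (simp add: coeff_quiver_def)

lemma arcs_CQ: "(a, x, y) \<in> arcs CQ \<longleftrightarrow> a \<in> arcs Q \<and> x \<in> B (tail Q a) \<and> y \<in> B (head Q a) \<and>
    coord (head Q a) (rep_map M a x) y \<noteq> 0"
  by (simp add: coeff_quiver_def)

lemma tail_CQ [simp]: "tail CQ (a, x, y) = (tail Q a, x)"
  and head_CQ [simp]: "head CQ (a, x, y) = (head Q a, y)"
  by (simp_all add: coeff_quiver_def)

lemma finite_B: "i \<in> verts Q \<Longrightarrow> finite (B i)"
proof -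
  assume i: "i \<in> verts Q"
  obtain S where S: "finite S" "span S = rep_space M i" using rep_finite_dim[OF i] by blast
  show ?thesis
    using independent_span_bound[OF S(1), of "B i"] span_superset[of "B i"] S(2)
      independent_B[OF i] span_B[OF i] by auto
qed

lemma B_in_space: "i \<in> verts Q \<Longrightarrow> b \<in> B i \<Longrightarrow> b \<in> rep_space M i"
  using span_B span_base by blast

lemma coord_sum: "i \<in> verts Q \<Longrightarrow> x \<in> rep_space M i \<Longrightarrow> (\<Sum>b\<in>B i. coord i x b *\<^sub>M b) = x"
  using sum_representation_eq[OF independent_B _ finite_B] span_B by auto

lemma height_step:
  assumes "\<alpha> \<in> arcs CQ"
  shows "height (head CQ \<alpha>) = Suc (height (tail CQ \<alpha>))"
  unfolding height_def CQ.string_predecessors(1)[OF strings assms]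
  using CQ.string_predecessors(2)[OF strings assms] by simp

lemma walk_height:
  assumes "(v, w) \<in> arcs_ends CQ ^^ k"
  shows "height w = height v + k" "string_of w = string_of v"
  using assms
proof (induction k arbitrary: w)
  case (Suc k)
  case 1
  then obtain y where "(v, y) \<in> arcs_ends CQ ^^ k" "(y, w) \<in> arcs_ends CQ" by auto
  then show ?case using Suc(1)[of y] height_step by (auto simp: arcs_ends_conv)
next
  case (Suc k)
  case 2
  then obtain y where "(v, y) \<in> arcs_ends CQ ^^ k" "(y, w) \<in> arcs_ends CQ" by auto
  then show ?case using Suc(2)[of y] CQ.component_of_arc(1) by (auto simp: arcs_ends_conv)
qed simp_all

text \<open>The height grows by one along each arc, so it decides between the two directions left
  open by \<open>string_walk\<close> and fixes the length.\<close>

lemma string_walk_height: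
  assumes "v \<in> verts CQ" "w \<in> verts CQ" "string_of v = string_of w" "height w = height v + k"
  shows "(v, w) \<in> arcs_ends CQ ^^ k"
proof -
  obtain l where "(v, w) \<in> arcs_ends CQ ^^ l \<or> (w, v) \<in> arcs_ends CQ ^^ l"
    using CQ.string_walk[OF strings assms(1,2,3)] by blast
  then show ?thesis
  proof
    assume "(v, w) \<in> arcs_ends CQ ^^ l"
    with walk_height(1)[OF this] assms(4) show ?thesis by simp
  next
    assume l: "(w, v) \<in> arcs_ends CQ ^^ l"
    with walk_height(1)[OF l] assms(4) have "l = 0" "k = 0" by simp_all
    with l show ?thesis by simp
  qed
qed

lemma vertex_eqI:
  assumes "v \<in> verts CQ" "w \<in> verts CQ" "string_of v = string_of w" "height v = height w"
  shows "v = w"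
  using string_walk_height[of v w 0] assms by simp

text \<open>At most one arc of the coefficient quiver leaves a vertex, so all coefficients other
  than the one at \<open>y\<close> vanish.\<close>

lemma rep_map_arc:
  assumes "(a, x, y) \<in> arcs CQ"
  shows "rep_map M a x = coord (head Q a) (rep_map M a x) y *\<^sub>M y"
proof -
  from assms have a: "a \<in> arcs Q" "x \<in> B (tail Q a)" "y \<in> B (head Q a)" by (auto simp: arcs_CQ)
  have "rep_map M a x \<in> rep_space M (head Q a)"
    using a B_in_space rep_map_closed by simp
  then have "rep_map M a x = (\<Sum>b\<in>B (head Q a). coord (head Q a) (rep_map M a x) b *\<^sub>M b)"
    using coord_sum a by simp
  also have "\<dots> = (\<Sum>b\<in>{y}. coord (head Q a) (rep_map M a x) b *\<^sub>M b)"
  proof (rule sum.mono_neutral_right)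
    show "\<forall>b\<in>B (head Q a) - {y}. coord (head Q a) (rep_map M a x) b *\<^sub>M b = 0"
    proof
      fix b assume b: "b \<in> B (head Q a) - {y}"
      then have "(a, x, b) \<notin> arcs CQ"
        using CQ.string_out_unique[OF strings assms, of "(a, x, b)"] by auto
      then show "coord (head Q a) (rep_map M a x) b *\<^sub>M b = 0"
        using a b by (simp add: arcs_CQ)
    qed
  qed (use a finite_B in auto)
  finally show ?thesis by simp
qed

lemma rep_map_no_arc:
  assumes "a \<in> arcs Q" "x \<in> B (tail Q a)" "\<And>y. (a, x, y) \<notin> arcs CQ"
  shows "rep_map M a x = 0"
proof -
  have "rep_map M a x \<in> rep_space M (head Q a)"
    using assms B_in_space rep_map_closed by simp
  then have "rep_map M a x = (\<Sum>b\<in>B (head Q a). coord (head Q a) (rep_map M a x) b *\<^sub>M b)"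
    using coord_sum assms by simp
  also have "\<dots> = 0"
    using assms by (intro sum.neutral) (auto simp: arcs_CQ)
  finally show ?thesis .
qed

lemma rep_map_zero: "a \<in> arcs Q \<Longrightarrow> rep_map M a 0 = 0"
  using rep_map_scale[of a 0 0] subspace_0[OF rep_subspace] by simp

lemma rep_map_sum:
  assumes "a \<in> arcs Q" "\<And>k. k \<in> K \<Longrightarrow> f k \<in> rep_space M (tail Q a)"
  shows "rep_map M a (sum f K) = (\<Sum>k\<in>K. rep_map M a (f k))"
  using assms(2)
proof (induction K rule: infinite_finite_induct)
  case (insert k K)
  then have "sum f K \<in> rep_space M (tail Q a)"
    using assms(1) by (intro subspace_sum[OF rep_subspace]) auto
  with insert show ?case using assms(1) by (simp add: rep_map_add)
qed (use assms(1) rep_map_zero in auto)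

end


section \<open>The torus action\<close>

lemma group_complex_units: "group complex_units"
proof (rule groupI)
  fix x assume "x \<in> carrier complex_units"
  then show "\<exists>y\<in>carrier complex_units. y \<otimes>\<^bsub>complex_units\<^esub> x = \<one>\<^bsub>complex_units\<^esub>"
    by (intro bexI[of _ "inverse x"]) (auto simp: complex_units_def)
qed (auto simp: complex_units_def)

context straight_rep
begin

abbreviation torus where "torus \<equiv> rep_torus Q M B"

abbreviation weight where "weight \<equiv> torus_weight Q M B"

abbreviation tmap where "tmap \<equiv> torus_map Q M B"

lemma group_torus: "group torus"
  unfolding rep_torus_def
  by (intro DirProd_group product_group group_complex_units)

lemma carrier_torus: "t \<in> carrier torus \<longleftrightarrow>
    fst t \<in> (\<Pi>\<^sub>E C\<in>components CQ. - {0}) \<and> snd t \<in> (\<Pi>\<^sub>E a\<in>supp_arcs Q M. - {0})"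
  by (simp add: rep_torus_def complex_units_def mem_Times_iff)

lemma torus_mult: "s \<otimes>\<^bsub>torus\<^esub> t =
    (\<lambda>C\<in>components CQ. fst s C * fst t C, \<lambda>a\<in>supp_arcs Q M. snd s a * snd t a)"
  by (cases s; cases t) (simp add: rep_torus_def complex_units_def)

lemma torus_one: "\<one>\<^bsub>torus\<^esub> = (\<lambda>C\<in>components CQ. 1, \<lambda>a\<in>supp_arcs Q M. 1)"
  by (simp add: rep_torus_def complex_units_def)

text \<open>Torus elements are extensional, with meaningful values only on \<open>supp_arcs\<close>;
  this fact makes every factor of a weight a genuine coordinate of the torus.\<close>

lemma arc_label_in_supp: "\<alpha> \<in> arcs CQ \<Longrightarrow> fst \<alpha> \<in> supp_arcs Q M"
  by (cases \<alpha>) (auto simp: arcs_CQ supp_arcs_def representation_zero intro!: bexI[OF _ B_in_space])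

lemma string_of_in_components: "v \<in> verts CQ \<Longrightarrow> string_of v \<in> components CQ"
  by (rule CQ.component_of_in(1))

lemma weight_eq: "weight t v =
    fst t (string_of v) * (\<Prod>\<alpha> | \<alpha> \<in> arcs CQ \<and> head CQ \<alpha> \<rightarrow>\<^sup>*\<^bsub>CQ\<^esub> v. snd t (fst \<alpha>))"
  by (simp add: torus_weight_def Let_def)

lemma weight_nonzero: "t \<in> carrier torus \<Longrightarrow> v \<in> verts CQ \<Longrightarrow> weight t v \<noteq> 0"
  using string_of_in_components[of v] arc_label_in_supp CQ.finite_arcs
  by (auto simp: carrier_torus weight_eq PiE_iff)

lemma weight_mult: "v \<in> verts CQ \<Longrightarrow> weight (s \<otimes>\<^bsub>torus\<^esub> t) v = weight s v * weight t v"
  using string_of_in_components arc_label_in_supp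
  by (simp add: torus_mult weight_eq prod.distrib)

lemma weight_one: "v \<in> verts CQ \<Longrightarrow> weight \<one>\<^bsub>torus\<^esub> v = 1"
  using string_of_in_components arc_label_in_supp
  by (simp add: torus_one weight_eq)

lemma coord_eqI:
  assumes "i \<in> verts Q" "x \<in> rep_space M i" "y \<in> rep_space M i"
    and "\<And>b. b \<in> B i \<Longrightarrow> coord i x b = coord i y b"
  shows "x = y"
  using coord_sum[OF assms(1,2)] coord_sum[OF assms(1,3)] assms(4) by (metis (no_types, lifting) sum.cong)

lemma coord_lincomb:
  assumes "i \<in> verts Q" "b \<in> B i"
  shows "coord i (\<Sum>c\<in>B i. f c *\<^sub>M c) b = f b"
proof -
  have "coord i (\<Sum>c\<in>B i. f c *\<^sub>M c) b = (\<Sum>c\<in>B i. if c = b then f c else 0)"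
    using assms
    by (subst representation_sum)
      (auto intro!: independent_B span_scale sum.cong
        simp: representation_scale span_base independent_B span_base representation_basis)
  then show ?thesis using assms finite_B by simp
qed

lemma tmap_closed: "i \<in> verts Q \<Longrightarrow> tmap t i x \<in> rep_space M i"
  unfolding torus_map_def
  by (intro subspace_sum[OF rep_subspace] subspace_scale[OF rep_subspace] B_in_space)

lemma coord_tmap: "i \<in> verts Q \<Longrightarrow> b \<in> B i \<Longrightarrow> coord i (tmap t i x) b = weight t (i, b) * coord i x b"
  unfolding torus_map_def by (rule coord_lincomb)

lemma coord_add: "i \<in> verts Q \<Longrightarrow> x \<in> rep_space M i \<Longrightarrow> y \<in> rep_space M i \<Longrightarrow>
    coord i (x + y) b = coord i x b + coord i y b"
  by (simp add: representation_add independent_B span_B)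

lemma coord_diff: "i \<in> verts Q \<Longrightarrow> x \<in> rep_space M i \<Longrightarrow> y \<in> rep_space M i \<Longrightarrow>
    coord i (x - y) b = coord i x b - coord i y b"
  by (simp add: representation_diff independent_B span_B)

lemma coord_scale: "i \<in> verts Q \<Longrightarrow> x \<in> rep_space M i \<Longrightarrow> coord i (c *\<^sub>M x) b = c * coord i x b"
  by (simp add: representation_scale independent_B span_B)

lemma coord_basis: "i \<in> verts Q \<Longrightarrow> b \<in> B i \<Longrightarrow> coord i b c = (if c = b then 1 else 0)"
  by (simp add: representation_basis independent_B)

lemma tmap_add: "i \<in> verts Q \<Longrightarrow> x \<in> rep_space M i \<Longrightarrow> y \<in> rep_space M i \<Longrightarrow>
    tmap t i (x + y) = tmap t i x + tmap t i y"
  by (simp add: torus_map_def coord_add scale_left_distrib ring_distribs sum.distrib)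

lemma tmap_scale: "i \<in> verts Q \<Longrightarrow> x \<in> rep_space M i \<Longrightarrow> tmap t i (c *\<^sub>M x) = c *\<^sub>M tmap t i x"
  by (simp add: torus_map_def coord_scale scale_sum_right mult.left_commute)

lemma tmap_basis: "i \<in> verts Q \<Longrightarrow> b \<in> B i \<Longrightarrow> tmap t i b = weight t (i, b) *\<^sub>M b"
  by (rule coord_eqI)
    (auto simp: tmap_closed subspace_scale[OF rep_subspace] B_in_space coord_tmap coord_scale coord_basis)

lemma tmap_mult: "i \<in> verts Q \<Longrightarrow> tmap (s \<otimes>\<^bsub>torus\<^esub> t) i x = tmap s i (tmap t i x)"
  by (rule coord_eqI[of i]) (simp_all add: tmap_closed coord_tmap weight_mult verts_CQ)

lemma tmap_one: "i \<in> verts Q \<Longrightarrow> x \<in> rep_space M i \<Longrightarrow> tmap \<one>\<^bsub>torus\<^esub> i x = x"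
  by (rule coord_eqI[of i]) (simp_all add: tmap_closed coord_tmap weight_one verts_CQ)

lemma tmap_inv:
  assumes "t \<in> carrier torus" "i \<in> verts Q" "x \<in> rep_space M i"
  shows "tmap (inv\<^bsub>torus\<^esub> t) i (tmap t i x) = x" "tmap t i (tmap (inv\<^bsub>torus\<^esub> t) i x) = x"
  using assms group.l_inv[OF group_torus] group.r_inv[OF group_torus] tmap_one
  by (simp_all flip: tmap_mult)

lemma tmap_zero: "tmap t i 0 = 0"
  by (simp add: torus_map_def representation_zero)

lemma tmap_sum:
  assumes "i \<in> verts Q" "\<And>k. k \<in> K \<Longrightarrow> f k \<in> rep_space M i"
  shows "tmap t i (sum f K) = (\<Sum>k\<in>K. tmap t i (f k))"
  using assms(2)
proof (induction K rule: infinite_finite_induct)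
  case (insert k K)
  then have "sum f K \<in> rep_space M i"
    using assms(1) by (intro subspace_sum[OF rep_subspace]) auto
  with insert show ?case using assms(1) by (simp add: tmap_add)
qed (use tmap_zero in auto)

text \<open>If an arc over \<open>a\<close> leaves \<open>b\<close>, its head has the weight of
  \<open>b\<close> times \<open>snd t a\<close>; otherwise both sides vanish.\<close>

lemma tmap_rep_map_basis:
  assumes "a \<in> arcs Q" "b \<in> B (tail Q a)"
  shows "tmap t (head Q a) (rep_map M a b) = snd t a *\<^sub>M rep_map M a (tmap t (tail Q a) b)"
proof (cases "\<exists>y. (a, b, y) \<in> arcs CQ")
  case True
  then obtain y where y: "(a, b, y) \<in> arcs CQ" by blast
  then have yB: "y \<in> B (head Q a)" by (simp add: arcs_CQ)
  let ?c = "coord (head Q a) (rep_map M a b) y"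
  have "tmap t (head Q a) (rep_map M a b) = ?c *\<^sub>M weight t (head Q a, y) *\<^sub>M y"
    by (subst rep_map_arc[OF y]) (use assms yB in \<open>simp add: tmap_scale tmap_basis B_in_space\<close>)
  also have "weight t (head Q a, y) = weight t (tail Q a, b) * snd t a"
    using torus_weight_step[OF straightening y] by simp
  also have "?c *\<^sub>M (weight t (tail Q a, b) * snd t a) *\<^sub>M y =
      snd t a *\<^sub>M weight t (tail Q a, b) *\<^sub>M ?c *\<^sub>M y"
    by (simp add: mult_ac)
  also have "?c *\<^sub>M y = rep_map M a b" by (rule rep_map_arc[OF y, symmetric])
  also have "weight t (tail Q a, b) *\<^sub>M rep_map M a b = rep_map M a (tmap t (tail Q a) b)"
    using assms by (simp add: tmap_basis rep_map_scale B_in_space)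
  finally show ?thesis .
next
  case False
  then show ?thesis
    using assms rep_map_no_arc[OF assms] by (simp add: tmap_basis tmap_zero rep_map_scale B_in_space)
qed

text \<open>The torus does not act by automorphisms of \<open>M\<close>: it commutes with an arrow
  map only up to a scalar. This suffices for subrepresentations, as subspaces absorb
  scalars.\<close>

lemma tmap_rep_map:
  assumes a: "a \<in> arcs Q" and x: "x \<in> rep_space M (tail Q a)"
  shows "tmap t (head Q a) (rep_map M a x) = snd t a *\<^sub>M rep_map M a (tmap t (tail Q a) x)"
proof -
  let ?i = "tail Q a" and ?j = "head Q a"
  have ij: "?i \<in> verts Q" "?j \<in> verts Q" using a by simp_all
  have Bi: "b \<in> rep_space M ?i" "rep_map M a b \<in> rep_space M ?j"
      "tmap t ?i b \<in> rep_space M ?i" "rep_map M a (tmap t ?i b) \<in> rep_space M ?j" if "b \<in> B ?i" for b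
    using that a ij by (simp_all add: B_in_space rep_map_closed tmap_closed)
  have x': "x = (\<Sum>b\<in>B ?i. coord ?i x b *\<^sub>M b)" using coord_sum[OF ij(1) x] by simp
  have "tmap t ?j (rep_map M a x) = (\<Sum>b\<in>B ?i. coord ?i x b *\<^sub>M tmap t ?j (rep_map M a b))"
    apply (subst x')
    using Bi a ij by (simp add: rep_map_sum tmap_sum subspace_scale[OF rep_subspace] rep_map_scale tmap_scale)
  also have "\<dots> = snd t a *\<^sub>M rep_map M a (\<Sum>b\<in>B ?i. coord ?i x b *\<^sub>M tmap t ?i b)"
    using Bi a ij
    by (simp add: rep_map_sum subspace_scale[OF rep_subspace] rep_map_scale tmap_rep_map_basis
        scale_sum_right mult.commute)
  also have "(\<Sum>b\<in>B ?i. coord ?i x b *\<^sub>M tmap t ?i b) = tmap t ?i (\<Sum>b\<in>B ?i. coord ?i x b *\<^sub>M b)"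
    using Bi ij by (simp add: tmap_sum subspace_scale[OF rep_subspace] tmap_scale)
  also have "\<dots> = tmap t ?i x" using coord_sum[OF ij(1) x] by simp
  finally show ?thesis .
qed

text \<open>\<open>representation\<close> is zero outside the span, so \<open>tmap\<close> need not
  be linear on the ambient space. Facts about linear maps are applied to a linear extension from the
  basis that agrees with it on \<open>rep_space M i\<close>.\<close>

lemma tmap_linear:
  assumes "i \<in> verts Q"
  obtains L where "Vector_Spaces.linear (rep_scale M) (rep_scale M) L"
    and "\<And>x. x \<in> rep_space M i \<Longrightarrow> L x = tmap t i x"
proof -
  interpret VP: vector_space_pair "rep_scale M" "rep_scale M" ..
  obtain L where L: "Vector_Spaces.linear (rep_scale M) (rep_scale M) L" "\<And>b. b \<in> B i \<Longrightarrow> L b = tmap t i b"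
    using VP.linear_independent_extend[OF independent_B[OF assms]] by blast
  have "L x = tmap t i x" if x: "x \<in> rep_space M i" for x
  proof -
    have "L (\<Sum>b\<in>B i. coord i x b *\<^sub>M b) = tmap t i (\<Sum>b\<in>B i. coord i x b *\<^sub>M b)"
      using assms
      by (simp add: VP.linear_sum[OF L(1)] VP.linear_scale[OF L(1)] L(2) tmap_sum tmap_scale
          subspace_scale[OF rep_subspace] B_in_space)
    then show ?thesis using coord_sum[OF assms x] by simp
  qed
  with L(1) that show ?thesis by blast
qed

lemma tmap_inj_on:
  assumes "t \<in> carrier torus" "i \<in> verts Q"
  shows "inj_on (tmap t i) (rep_space M i)"
  by (rule inj_on_inverseI[of _ "tmap (inv\<^bsub>torus\<^esub> t) i"]) (use assms tmap_inv in auto)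

lemma tmap_frame:
  assumes t: "t \<in> carrier torus" and i: "i \<in> verts Q" and S: "S \<subseteq> rep_space M i" "independent S"
  shows "independent (tmap t i ` S)" "span (tmap t i ` S) = tmap t i ` span S"
proof -
  interpret VP: vector_space_pair "rep_scale M" "rep_scale M" ..
  obtain L where L: "Vector_Spaces.linear (rep_scale M) (rep_scale M) L"
    and eq: "\<And>x. x \<in> rep_space M i \<Longrightarrow> L x = tmap t i x"
    using tmap_linear[OF i] by blast
  have sp: "span S \<subseteq> rep_space M i" using span_minimal[OF S(1) rep_subspace[OF i]] .
  have im: "L ` S = tmap t i ` S" "L ` span S = tmap t i ` span S"
    using eq S(1) sp by (auto intro!: image_cong)
  have "inj_on L (span S)"
    using inj_on_subset[OF tmap_inj_on[OF t i] sp] eq sp by (metis (no_types, lifting) inj_on_cong subsetD)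
  then show "independent (tmap t i ` S)"
    using VP.linear_independent_injective_image[OF L S(2)] im by simp
  show "span (tmap t i ` S) = tmap t i ` span S"
    using VP.linear_span_image[OF L, of S] im by simp
qed

end


section \<open>Closed subsets of the product of Grassmannians\<close>

lemma (in vector_space) independent_Un_span_Int:
  assumes S: "independent S" and T: "independent T" and ST: "span S \<inter> span T = {0}"
  shows "independent (S \<union> T)"
  unfolding dependent_explicit
proof (intro notI, elim exE conjE)
  fix t u assume t: "finite t" "t \<subseteq> S \<union> T" "(\<Sum>v\<in>t. scale (u v) v) = 0" "\<exists>v\<in>t. u v \<noteq> 0"
  have split: "(\<Sum>v\<in>t \<inter> S. scale (u v) v) + (\<Sum>v\<in>t - S. scale (u v) v) = 0"
    using t(1,3) by (simp add: sum.Int_Diff[of t _ S])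
  have 1: "(\<Sum>v\<in>t \<inter> S. scale (u v) v) \<in> span S"
    by (intro span_sum span_scale span_base) auto
  have 2: "(\<Sum>v\<in>t - S. scale (u v) v) \<in> span T"
    by (intro span_sum span_scale span_base) (use t(2) in auto)
  have "(\<Sum>v\<in>t \<inter> S. scale (u v) v) = - (\<Sum>v\<in>t - S. scale (u v) v)"
    using split by (simp add: eq_neg_iff_add_eq_0)
  then have "(\<Sum>v\<in>t \<inter> S. scale (u v) v) \<in> span S \<inter> span T"
    using 1 span_neg[OF 2] by simp
  then have "(\<Sum>v\<in>t \<inter> S. scale (u v) v) = 0" unfolding ST by simp
  moreover from this split have "(\<Sum>v\<in>t - S. scale (u v) v) = 0" by simp
  ultimately have "u v = 0" if "v \<in> t" for v
    using independentD[OF S, of "t \<inter> S" u v] independentD[OF T, of "t - S" u v] that t(1,2) by blast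
  with t(4) show False by blast
qed

lemma (in vector_space) independent_Un_disjoint:
  assumes "independent S" "span S \<inter> span T = {0}"
  shows "S \<inter> T = {}"
proof (rule ccontr)
  assume "S \<inter> T \<noteq> {}"
  then obtain x where x: "x \<in> S" "x \<in> T" by blast
  then have "x \<in> span S \<inter> span T" by (simp add: span_base)
  with assms(2) have "x = 0" by simp
  with x(1) assms(1) dependent_zero show False by blast
qed

lemma frame_polys_sum:
  "(\<And>k. k \<in> K \<Longrightarrow> f k \<in> frame_polys Q M e) \<Longrightarrow> (\<lambda>F. \<Sum>k\<in>K. f k F) \<in> frame_polys Q M e"
  by (induction K rule: infinite_finite_induct) (auto intro: frame_polys.intros)

lemma frame_polys_prod:
  "(\<And>k. k \<in> K \<Longrightarrow> f k \<in> frame_polys Q M e) \<Longrightarrow> (\<lambda>F. \<Prod>k\<in>K. f k F) \<in> frame_polys Q M e"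
  by (induction K rule: infinite_finite_induct) (auto intro: frame_polys.intros)

lemma sum_lessThan_add:
  fixes f :: "nat \<Rightarrow> 'a::comm_monoid_add"
  shows "(\<Sum>l<k + n. f l) = (\<Sum>l<k. f l) + (\<Sum>l<n. f (k + l))"
  by (induction n) (simp_all add: add_ac)

context quiver_representation
begin

text \<open>Membership in a closed set is read off from polynomials on frames, so each point needs a
  frame; later the torus moves one chosen frame of \<open>U\<close>.\<close>

lemma frame_exists:
  assumes "U \<in> prod_grassmannian Q M e"
  shows "\<exists>F. F \<in> frames Q M e U"
proof -
  have "\<exists>f. f \<in> {..<nat (e i)} \<rightarrow>\<^sub>E rep_space M i \<and> inj_on f {..<nat (e i)} \<and>
      independent (f ` {..<nat (e i)}) \<and> span (f ` {..<nat (e i)}) = U i" if i: "i \<in> verts Q" for i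
  proof -
    from assms i have U: "subspace (U i)" "U i \<subseteq> rep_space M i" "int (dim (U i)) = e i"
      unfolding prod_grassmannian_def by auto
    obtain D where D: "D \<subseteq> U i" "independent D" "U i \<subseteq> span D" "card D = dim (U i)"
      using basis_exists by blast
    obtain S where S: "finite S" "span S = rep_space M i" using rep_finite_dim[OF i] by blast
    have "finite D" using independent_span_bound[OF S(1) D(2)] S(2) D(1) U(2) by auto
    then obtain f where f: "bij_betw f {..<nat (e i)} D"
      using D(4) U(3) ex_bij_betw_nat_finite[of D] by (metis atLeast0LessThan nat_int)
    have "span D = U i" using span_minimal[OF D(1) U(1)] D(3) by blast
    moreover have "f ` {..<nat (e i)} = D" "inj_on f {..<nat (e i)}"
      using f by (auto simp: bij_betw_def)
    ultimately show ?thesis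
      using D U(2)
      by (intro exI[of _ "restrict f {..<nat (e i)}"])
        (auto simp: inj_on_restrict_eq)
  qed
  then obtain f where f: "\<And>i. i \<in> verts Q \<Longrightarrow> f i \<in> {..<nat (e i)} \<rightarrow>\<^sub>E rep_space M i \<and>
      inj_on (f i) {..<nat (e i)} \<and> independent (f i ` {..<nat (e i)}) \<and>
      span (f i ` {..<nat (e i)}) = U i"
    by metis
  then have "restrict f (verts Q) \<in> frames Q M e U" unfolding frames_def by simp
  then show ?thesis by blast
qed

text \<open>The equations are the determinants of all families of functionals on the frame together with \<open>S\<close>.\<close>

lemma zariski_closed_meet:
  assumes i: "i \<in> verts Q" and S: "finite S" "independent S"
  shows "zariski_closed Q M e {W \<in> prod_grassmannian Q M e. W i \<inter> span S \<noteq> {0}}"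
proof -
  define k n where "k = nat (e i)" and "n = card S"
  obtain y where y: "bij_betw y {..<n} S"
    using ex_bij_betw_nat_finite[OF S(1)] unfolding n_def by (metis atLeast0LessThan)
  \<comment> \<open>The columns to come: first the \<open>k\<close> frame vectors, then the
    \<open>n\<close> fixed basis vectors of \<open>span S\<close>. The space meets
    \<open>span S\<close> nontrivially exactly if these \<open>k + n\<close> vectors satisfy a
    linear relation.\<close>
  define z where "z = (\<lambda>F :: 'v \<Rightarrow> nat \<Rightarrow> 'm. \<lambda>l. if l < k then F i l else y (l - k))"
  define A where "A = (\<lambda>\<theta> F. mat (k + n) (k + n) (\<lambda>(j, l). \<theta> j (z F l) :: complex))"
  define P where "P = {\<lambda>F. det (A \<theta> F) | \<theta>. \<forall>j<k+n. Vector_Spaces.linear (rep_scale M) (*) (\<theta> j)}"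
  have carr: "A \<theta> F \<in> carrier_mat (k + n) (k + n)" for \<theta> F by (simp add: A_def)
  have "P \<subseteq> frame_polys Q M e"
  proof
    fix p assume "p \<in> P"
    then obtain \<theta> where \<theta>: "\<And>j. j < k+n \<Longrightarrow> Vector_Spaces.linear (rep_scale M) (*) (\<theta> j)"
      and p: "p = (\<lambda>F. det (A \<theta> F))" unfolding P_def by blast
    have "(\<lambda>F. \<theta> j (z F l)) \<in> frame_polys Q M e" if "j < k + n" for j l
      using \<theta>[OF that] i unfolding z_def k_def
      by (cases "l < nat (e i)") (auto intro: frame_polys.intros)
    then have "(\<lambda>F. \<Sum>\<pi> \<in> {\<pi>. \<pi> permutes {0..<k+n}}. signof \<pi> * (\<Prod>j = 0..<k+n. \<theta> j (z F (\<pi> j))))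
        \<in> frame_polys Q M e"
      by (intro frame_polys_sum frame_polys.mult frame_polys.const frame_polys_prod) auto
    moreover have perm: "\<pi> j < k + n" if "\<pi> permutes {0..<k+n}" "j < k + n" for \<pi> j
      using permutes_in_image[OF that(1), of j] that(2) by simp
    have "(\<lambda>F. \<Sum>\<pi> \<in> {\<pi>. \<pi> permutes {0..<k+n}}. signof \<pi> * (\<Prod>j = 0..<k+n. \<theta> j (z F (\<pi> j)))) = p"
      unfolding p det_def'[OF carr] unfolding A_def
      by (intro ext sum.cong arg_cong2[where f = "(*)"] prod.cong) (auto simp: perm)
    ultimately show "p \<in> frame_polys Q M e" by simp
  qed
  moreover have "W \<in> {W \<in> prod_grassmannian Q M e. W i \<inter> span S \<noteq> {0}} \<longleftrightarrow> (\<forall>p\<in>P. p F = 0)"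
    if W: "W \<in> prod_grassmannian Q M e" and F: "F \<in> frames Q M e W" for W F
  proof -
    let ?E = "F i ` {..<k}"
    have E: "inj_on (F i) {..<k}" "independent ?E" "span ?E = W i"
      using F i unfolding frames_def k_def by auto
    have yS: "y ` {..<n} = S" "inj_on y {..<n}" using y by (auto simp: bij_betw_def)
    have z: "z F l = F i l" if "l < k" for l using that by (simp add: z_def)
    have z': "z F (k + l) = y l" for l by (simp add: z_def)
    show ?thesis
    proof (cases "W i \<inter> span S = {0}")
      case False
      then obtain x where x: "x \<in> span ?E" "x \<in> span S" "x \<noteq> 0"
        using E(3) span_zero[of ?E] span_zero[of S] by auto
      obtain u where u: "x = (\<Sum>v\<in>?E. rep_scale M (u v) v)" using x(1) by (auto simp: span_finite)
      obtain w where w: "x = (\<Sum>v\<in>S. rep_scale M (w v) v)" using x(2) S(1) by (auto simp: span_finite)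
      \<comment> \<open>The difference of the two expansions of \<open>x\<close> is a relation
        between the columns. It is respected by every functional, so it lies in the kernel of the
        matrix whatever \<open>\<theta>\<close> is.\<close>
      define c where "c l = (if l < k then u (F i l) else - w (y (l - k)))" for l
      have xu: "x = (\<Sum>l<k. rep_scale M (c l) (z F l))"
        unfolding u by (subst sum.reindex[OF E(1)]) (simp add: c_def z)
      have xw: "x = - (\<Sum>l<n. rep_scale M (c (k + l)) (z F (k + l)))"
        unfolding w yS(1)[symmetric]
        by (subst sum.reindex[OF yS(2)]) (simp add: c_def z' sum_negf)
      have "(\<Sum>l<k+n. rep_scale M (c l) (z F l)) = 0"
        unfolding sum_lessThan_add xu[symmetric] by (subst xw) (rule add.left_inverse)
      then have dep: "(\<Sum>l=0..<k+n. rep_scale M (c l) (z F l)) = 0"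
        by (simp add: atLeast0LessThan)
      \<comment> \<open>The first \<open>k\<close> coefficients already determine \<open>x\<close>,
        which is nonzero.\<close>
      have c0: "vec (k + n) c \<noteq> 0\<^sub>v (k + n)"
      proof
        assume c: "vec (k + n) c = 0\<^sub>v (k + n)"
        have "c l = 0" if "l < k" for l
          using arg_cong[OF c, of "\<lambda>v. v $ l"] that by simp
        with xu x(3) show False by simp
      qed
      have "det (A \<theta> F) = 0" if \<theta>: "\<forall>j<k+n. Vector_Spaces.linear (rep_scale M) (*) (\<theta> j)" for \<theta>
      proof -
        interpret VC: vector_space_pair "rep_scale M" "(*) :: complex \<Rightarrow> complex \<Rightarrow> complex"
          by unfold_locales (auto simp: algebra_simps)
        have "A \<theta> F *\<^sub>v vec (k + n) c = 0\<^sub>v (k + n)"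
        proof (rule eq_vecI)
          fix j assume "j < dim_vec (0\<^sub>v (k + n) :: complex vec)"
          then have j: "j < k + n" by simp
          have lin: "Vector_Spaces.linear (rep_scale M) (*) (\<theta> j)" using \<theta> j by simp
          have "(A \<theta> F *\<^sub>v vec (k + n) c) $ j = (\<Sum>l=0..<k+n. \<theta> j (z F l) * c l)"
            using j by (simp add: A_def scalar_prod_def)
          also have "\<dots> = \<theta> j (\<Sum>l=0..<k+n. rep_scale M (c l) (z F l))"
            by (simp add: VC.linear_sum[OF lin] VC.linear_scale[OF lin] mult.commute)
          also have "\<dots> = 0" by (simp only: dep VC.linear_0[OF lin])
          finally show "(A \<theta> F *\<^sub>v vec (k + n) c) $ j = 0\<^sub>v (k + n) $ j" using j by simp
        qed (simp add: A_def)
        then show ?thesis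
          using det_0_iff_vec_prod_zero[OF carr, of \<theta> F] c0 vec_carrier[of "k + n" c] by blast
      qed
      then show ?thesis using W False unfolding P_def by auto
    next
      case True
      have ind: "independent (?E \<union> S)" and disj: "?E \<inter> S = {}"
        using independent_Un_span_Int[OF E(2) S(2)] independent_Un_disjoint[OF E(2)] True E(3) by auto
      have zE: "z F l \<in> ?E \<union> S" if "l < k + n" for l
        using that yS(1) by (auto simp: z_def)
      have inj: "l = l'" if "l < k + n" "l' < k + n" "z F l = z F l'" for l l'
      proof -
        have l: "z F l \<in> ?E \<longleftrightarrow> l < k" if "l < k + n" for l
        proof (cases "l < k")
          case False
          then have "l - k < n" using that by simp
          then have "z F l \<in> S" using yS(1) False by (auto simp: z_def)
          then show ?thesis using disj False by blast
        qed (simp add: z)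
        show ?thesis
        proof (cases "l < k")
          case True
          then show ?thesis using l that z E(1) by (metis inj_onD lessThan_iff)
        next
          case False
          then have "\<not> l' < k" using l that by metis
          moreover from this False have "l - k \<in> {..<n}" "l' - k \<in> {..<n}" "y (l - k) = y (l' - k)"
            using that by (auto simp: z_def)
          ultimately show ?thesis
            using False inj_onD[OF yS(2)] by (metis eq_diff_iff not_less)
        qed
      qed
      interpret VC: vector_space_pair "rep_scale M" "(*) :: complex \<Rightarrow> complex \<Rightarrow> complex"
        by unfold_locales (auto simp: algebra_simps)
      \<comment> \<open>The functionals dual to the independent columns turn the matrix into the
        identity, so one of the determinants is nonzero.\<close>
      have "\<exists>\<theta>. Vector_Spaces.linear (rep_scale M) (*) \<theta> \<and>
          (\<forall>x\<in>?E \<union> S. \<theta> x = (if x = z F j then 1 else 0 :: complex))" for j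
        using VC.linear_independent_extend[OF ind] .
      then obtain \<theta> where \<theta>: "\<And>j. Vector_Spaces.linear (rep_scale M) (*) (\<theta> j)"
          "\<And>j x. x \<in> ?E \<union> S \<Longrightarrow> \<theta> j x = (if x = z F j then 1 else 0 :: complex)"
        by metis
      have "A \<theta> F = 1\<^sub>m (k + n)"
        by (rule eq_matI) (use \<theta>(2)[OF zE] inj in \<open>auto simp: A_def\<close>)
      then have "det (A \<theta> F) \<noteq> 0" by simp
      then show ?thesis using True \<theta>(1) unfolding P_def by auto
    qed
  qed
  ultimately show ?thesis
    unfolding zariski_closed_def by (intro conjI exI[of _ P] ballI) auto
qed

lemma closedin_orbit_zariski:
  assumes "X \<subseteq> quiver_grassmannian Q M e"
  shows "closedin (subtopology (quiver_grassmannian_zariski Q M e) X) Y \<longleftrightarrow>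
    (\<exists>Z. zariski_closed Q M e Z \<and> Y = Z \<inter> X)"
proof -
  have "quiver_grassmannian Q M e \<inter> X = X" using assms by blast
  then show ?thesis
    unfolding quiver_grassmannian_zariski_def subtopology_subtopology
    by (simp add: closedin_subtopology closedin_prod_grassmannian_zariski)
qed

lemma topspace_orbit_zariski:
  assumes "X \<subseteq> quiver_grassmannian Q M e"
  shows "topspace (subtopology (quiver_grassmannian_zariski Q M e) X) = X"
  using assms
  by (auto simp: quiver_grassmannian_zariski_def topspace_prod_grassmannian_zariski quiver_grassmannian_def)

end

section \<open>Irreducible sets\<close>

lemma irreducible_in_closure_of:
  assumes "irreducible_in X S"
  shows "irreducible_in X (X closure_of S)"
proof -
  have S: "S \<subseteq> topspace X" "S \<noteq> {}" using assms unfolding irreducible_in_def by auto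
  then have sub: "S \<subseteq> X closure_of S" by (simp add: closure_of_subset)
  show ?thesis
    unfolding irreducible_in_def
  proof (intro conjI allI impI)
    show "X closure_of S \<subseteq> topspace X" by (rule closure_of_subset_topspace)
    show "X closure_of S \<noteq> {}" using sub S(2) by blast
    fix Y Z assume YZ: "closedin X Y" "closedin X Z" "X closure_of S \<subseteq> Y \<union> Z"
    then have "S \<subseteq> Y \<or> S \<subseteq> Z" using assms sub unfolding irreducible_in_def by (meson subset_trans)
    then show "X closure_of S \<subseteq> Y \<or> X closure_of S \<subseteq> Z"
      using YZ closure_of_minimal by metis
  qed
qed

text \<open>The sets \<open>S0\<close>, \<open>S1\<close>, \<open>S2\<close> need not be closed: the
  chain consists of their closures, which stay irreducible. Each \<open>Y\<close> is closed, hence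
  contains the closure of the smaller set but not that of the larger one, which makes the inclusions
  strict.\<close>

lemma krull_dim_ne_1:
  assumes "irreducible_in X S0" "irreducible_in X S1" "irreducible_in X S2"
    and "S0 \<subseteq> S1" "S1 \<subseteq> S2"
    and "closedin X Y1" "S0 \<subseteq> Y1" "\<not> S1 \<subseteq> Y1"
    and "closedin X Y2" "S1 \<subseteq> Y2" "\<not> S2 \<subseteq> Y2"
  shows "krull_dim X \<noteq> 1"
proof -
  define Z where "Z = (\<lambda>k :: nat. X closure_of (if k = 0 then S0 else if k = 1 then S1 else S2))"
  have S: "S0 \<subseteq> topspace X" "S1 \<subseteq> topspace X" "S2 \<subseteq> topspace X"
    using assms(1-3) unfolding irreducible_in_def by auto
  have "X closure_of S0 \<subseteq> Y1" "X closure_of S1 \<subseteq> Y2"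
    using assms by (simp_all add: closure_of_minimal)
  moreover have "\<not> X closure_of S1 \<subseteq> Y1" "\<not> X closure_of S2 \<subseteq> Y2"
    using closure_of_subset[OF S(2)] closure_of_subset[OF S(3)] assms(8,11) by auto
  ultimately have "X closure_of S0 \<subset> X closure_of S1" "X closure_of S1 \<subset> X closure_of S2"
    using closure_of_mono[OF assms(4), of X] closure_of_mono[OF assms(5), of X] by blast+
  then have "\<forall>k<2. Z k \<subset> Z (Suc k)"
    by (auto simp: Z_def less_2_cases_iff)
  moreover have "\<forall>k\<le>2. closedin X (Z k) \<and> irreducible_in X (Z k)"
    using assms(1-3) by (auto simp: Z_def irreducible_in_closure_of)
  ultimately have "enat 2 \<le> krull_dim X"
    unfolding krull_dim_def by (intro Sup_upper CollectI exI[of _ 2]) blast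
  then show ?thesis by (auto simp: one_enat_def)
qed

definition polynomial_fun :: "(complex \<Rightarrow> complex) \<Rightarrow> bool" where
  "polynomial_fun f \<longleftrightarrow> (\<exists>p. \<forall>s. f s = poly p s)"

lemma polynomial_fun_const: "polynomial_fun (\<lambda>s. c)"
  unfolding polynomial_fun_def by (intro exI[of _ "[:c:]"]) simp

lemma polynomial_fun_ident: "polynomial_fun (\<lambda>s. s)"
  unfolding polynomial_fun_def by (intro exI[of _ "[:0, 1:]"]) simp

lemma polynomial_fun_add: "polynomial_fun f \<Longrightarrow> polynomial_fun g \<Longrightarrow> polynomial_fun (\<lambda>s. f s + g s)"
  unfolding polynomial_fun_def by (metis poly_add)

lemma polynomial_fun_mult: "polynomial_fun f \<Longrightarrow> polynomial_fun g \<Longrightarrow> polynomial_fun (\<lambda>s. f s * g s)"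
  unfolding polynomial_fun_def by (metis poly_mult)

lemma polynomial_fun_power: "polynomial_fun f \<Longrightarrow> polynomial_fun (\<lambda>s. f s ^ n)"
  by (induction n) (auto intro: polynomial_fun_const polynomial_fun_mult)

lemma polynomial_fun_sum: "(\<And>k. k \<in> K \<Longrightarrow> polynomial_fun (f k)) \<Longrightarrow> polynomial_fun (\<lambda>s. \<Sum>k\<in>K. f k s)"
  by (induction K rule: infinite_finite_induct) (auto intro: polynomial_fun_const polynomial_fun_add)

lemma polynomial_fun_prod: "(\<And>k. k \<in> K \<Longrightarrow> polynomial_fun (f k)) \<Longrightarrow> polynomial_fun (\<lambda>s. \<Prod>k\<in>K. f k s)"
  by (induction K rule: infinite_finite_induct) (auto intro: polynomial_fun_const polynomial_fun_mult)

lemma polynomial_fun_finite_zeros: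
  assumes "polynomial_fun f" "f s \<noteq> 0"
  shows "finite {s. f s = 0}"
proof -
  obtain p where p: "\<And>s. f s = poly p s" using assms(1) unfolding polynomial_fun_def by blast
  with assms(2) have "p \<noteq> 0" by auto
  then show ?thesis unfolding p by (rule poly_roots_finite)
qed


section \<open>The action on the quiver Grassmannian, and irreducible images of sets of torus
  elements\<close>

context straight_rep
begin

abbreviation Gr where "Gr \<equiv> quiver_grassmannian Q M"

abbreviation act where "act \<equiv> torus_action Q M B"

text \<open>The restrictions are there because \<open>frames\<close> only contains extensional
  families.\<close>

definition torus_frame where
  "torus_frame e t F = (\<lambda>i\<in>verts Q. \<lambda>k\<in>{..<nat (e i)}. tmap t i (F i k))"

lemma GrD:
  assumes "U \<in> Gr e"
  shows "U \<in> prod_grassmannian Q M e" "U \<in> extensional (verts Q)"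
    and "\<And>i. i \<in> verts Q \<Longrightarrow> subspace (U i)" "\<And>i. i \<in> verts Q \<Longrightarrow> U i \<subseteq> rep_space M i"
    and "\<And>i. i \<in> verts Q \<Longrightarrow> int (dim (U i)) = e i"
    and "\<And>a x. a \<in> arcs Q \<Longrightarrow> x \<in> U (tail Q a) \<Longrightarrow> rep_map M a x \<in> U (head Q a)"
  using assms unfolding quiver_grassmannian_def prod_grassmannian_def
  by (auto simp: PiE_iff image_subset_iff)

lemma act_apply: "U \<in> Gr e \<Longrightarrow> i \<in> verts Q \<Longrightarrow> act e t U i = tmap t i ` U i"
  by (simp add: torus_action_def)

lemma torus_frame_frames:
  assumes t: "t \<in> carrier torus" and U: "U \<in> Gr e" and F: "F \<in> frames Q M e U"
  shows "torus_frame e t F \<in> frames Q M e (act e t U)"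
  unfolding frames_def
proof (intro CollectI conjI ballI)
  show "torus_frame e t F \<in> (\<Pi>\<^sub>E i\<in>verts Q. {..<nat (e i)} \<rightarrow>\<^sub>E rep_space M i)"
    by (simp add: torus_frame_def PiE_iff tmap_closed)
next
  fix i assume i: "i \<in> verts Q"
  let ?K = "{..<nat (e i)}"
  have Fi: "F i ` ?K \<subseteq> rep_space M i" "inj_on (F i) ?K" "independent (F i ` ?K)" "span (F i ` ?K) = U i"
    using F i unfolding frames_def by (auto simp: PiE_iff)
  have im: "torus_frame e t F i ` ?K = tmap t i ` F i ` ?K"
    using i by (auto simp: torus_frame_def)
  have "inj_on (tmap t i \<circ> F i) ?K"
    using comp_inj_on[OF Fi(2) inj_on_subset[OF tmap_inj_on[OF t i] Fi(1)]] .
  then show "inj_on (torus_frame e t F i) ?K"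
    using i by (auto simp: torus_frame_def inj_on_def)
  show "independent (torus_frame e t F i ` ?K)"
    using tmap_frame(1)[OF t i Fi(1,3)] im by simp
  show "span (torus_frame e t F i ` ?K) = act e t U i"
    using tmap_frame(2)[OF t i Fi(1,3)] im Fi(4) act_apply[OF U i] by simp
qed

lemma act_closed:
  assumes t: "t \<in> carrier torus" and U: "U \<in> Gr e"
  shows "act e t U \<in> Gr e"
proof -
  obtain F where F: "F \<in> frames Q M e U" using frame_exists GrD(1)[OF U] by blast
  note F' = torus_frame_frames[OF t U F]
  have "act e t U \<in> prod_grassmannian Q M e"
    unfolding prod_grassmannian_def
  proof (rule PiE_I)
    fix i assume i: "i \<in> verts Q"
    let ?S = "torus_frame e t F i ` {..<nat (e i)}"
    have S: "inj_on (torus_frame e t F i) {..<nat (e i)}" "independent ?S" "span ?S = act e t U i"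
      using F' i unfolding frames_def by auto
    have "dim (act e t U i) = card ?S" using dim_span_eq_card_independent[OF S(2)] S(3) by simp
    also have "\<dots> = nat (e i)" using card_image[OF S(1)] by simp
    \<comment> \<open>Nothing is lost in \<open>nat (e i)\<close>: as the dimension of
      \<open>U i\<close>, the integer \<open>e i\<close> is nonnegative.\<close>
    finally have "int (dim (act e t U i)) = e i" using GrD(5)[OF U i] by simp
    moreover have "act e t U i \<subseteq> rep_space M i" 
      using tmap_closed[OF i] by (simp add: act_apply[OF U i] image_subset_iff)
    moreover have "subspace (act e t U i)" using subspace_span[of ?S] S(3) by simp
    ultimately show "act e t U i \<in> {V. subspace V \<and> V \<subseteq> rep_space M i \<and> int (dim V) = e i}" by simp
  qed (use U in \<open>simp add: torus_action_def\<close>)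
  moreover have "rep_map M a ` act e t U (tail Q a) \<subseteq> act e t U (head Q a)" if a: "a \<in> arcs Q" for a
  proof
    fix y assume "y \<in> rep_map M a ` act e t U (tail Q a)"
    then obtain u where u: "u \<in> U (tail Q a)" and y: "y = rep_map M a (tmap t (tail Q a) u)"
      using act_apply[OF U] a by auto
    have ij: "tail Q a \<in> verts Q" "head Q a \<in> verts Q" using a by simp_all
    have us: "u \<in> rep_space M (tail Q a)" using u GrD(4)[OF U ij(1)] by blast
    note Uj = GrD(3)[OF U ij(2)]
    have Mu: "rep_map M a u \<in> U (head Q a)" using GrD(6)[OF U a u] .
    show "y \<in> act e t U (head Q a)"
    \<comment> \<open>Only for arrows of the support is \<open>snd t a\<close> known to be
      invertible; the maps of all other arrows are zero.\<close>
    proof (cases "a \<in> supp_arcs Q M")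
      case True
      then have "snd t a \<noteq> 0" using t by (auto simp: carrier_torus PiE_iff)
      then have "y = inverse (snd t a) *\<^sub>M tmap t (head Q a) (rep_map M a u)"
        unfolding y tmap_rep_map[OF a us] by simp
      also have "\<dots> = tmap t (head Q a) (inverse (snd t a) *\<^sub>M rep_map M a u)"
        using tmap_scale[OF ij(2)] rep_map_closed[OF a us] by simp
      finally show ?thesis
        using act_apply[OF U ij(2)] subspace_scale[OF Uj Mu] by blast
    next
      case False
      then have "y = tmap t (head Q a) 0"
        using tmap_closed[OF ij(1)] a y by (auto simp: supp_arcs_def tmap_zero)
      then show ?thesis
        using act_apply[OF U ij(2)] subspace_0[OF Uj] by blast
    qed
  qed
  ultimately show ?thesis unfolding quiver_grassmannian_def by blast
qed

lemma act_mult: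
  assumes "s \<in> carrier torus" "t \<in> carrier torus" "U \<in> Gr e"
  shows "act e (s \<otimes>\<^bsub>torus\<^esub> t) U = act e s (act e t U)"
proof (rule extensionalityI[of _ "verts Q"])
  fix i assume i: "i \<in> verts Q"
  show "act e (s \<otimes>\<^bsub>torus\<^esub> t) U i = act e s (act e t U) i"
    using i assms act_closed by (simp add: act_apply image_image tmap_mult)
qed (use assms act_closed in \<open>simp_all add: torus_action_def\<close>)

lemma act_one:
  assumes "U \<in> Gr e"
  shows "act e \<one>\<^bsub>torus\<^esub> U = U"
proof (rule extensionalityI[of _ "verts Q"])
  fix i assume i: "i \<in> verts Q"
  have "tmap \<one>\<^bsub>torus\<^esub> i ` U i = id ` U i"
    using i GrD(4)[OF assms i] by (intro image_cong) (auto simp: tmap_one)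
  then show "act e \<one>\<^bsub>torus\<^esub> U i = U i" using act_apply[OF assms i] by simp
qed (use assms GrD(2) in \<open>simp_all add: torus_action_def\<close>)

lemma group_action_torus: "group_action torus (Gr e) (act e)"
proof -
  interpret T: Group.group torus by (rule group_torus)
  have bij: "act e t \<in> Bij (Gr e)" if t: "t \<in> carrier torus" for t
  proof -
    have "bij_betw (act e t) (Gr e) (Gr e)"
    proof (rule bij_betw_byWitness[where f' = "act e (inv\<^bsub>torus\<^esub> t)"])
      show "\<forall>U\<in>Gr e. act e (inv\<^bsub>torus\<^esub> t) (act e t U) = U"
        using t by (simp add: act_one flip: act_mult)
      show "\<forall>U\<in>Gr e. act e t (act e (inv\<^bsub>torus\<^esub> t) U) = U"
        using t by (simp add: act_one flip: act_mult)
    qed (use act_closed[OF t] act_closed[OF T.inv_closed[OF t]] in blast)+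
    then show ?thesis by (simp add: Bij_def torus_action_def)
  qed
  have "act e \<in> hom torus (BijGroup (Gr e))"
  proof (rule homI)
    fix s t assume st: "s \<in> carrier torus" "t \<in> carrier torus"
    have "act e (s \<otimes>\<^bsub>torus\<^esub> t) = compose (Gr e) (act e s) (act e t)"
    proof (rule extensionalityI[of _ "Gr e"])
      show "act e (s \<otimes>\<^bsub>torus\<^esub> t) \<in> extensional (Gr e)" by (simp add: torus_action_def)
      show "compose (Gr e) (act e s) (act e t) \<in> extensional (Gr e)" by (simp add: compose_def)
      fix U assume "U \<in> Gr e"
      then show "act e (s \<otimes>\<^bsub>torus\<^esub> t) U = compose (Gr e) (act e s) (act e t) U"
        using act_mult[OF st] by (simp add: compose_def)
    qed
    then show "act e (s \<otimes>\<^bsub>torus\<^esub> t) = act e s \<otimes>\<^bsub>BijGroup (Gr e)\<^esub> act e t"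
      using bij st by (simp add: BijGroup_def)
  qed (use bij in \<open>simp add: BijGroup_def\<close>)
  then show ?thesis
    unfolding group_action_def group_hom_def group_hom_axioms_def
    using group_torus group_BijGroup by blast
qed

text \<open>A curve in the affine space of coordinates; at some parameters it may leave the
  torus.\<close>

definition polynomial_curve where
  "polynomial_curve g \<longleftrightarrow> (\<forall>C\<in>components CQ. polynomial_fun (\<lambda>s. fst (g s) C)) \<and>
    (\<forall>a\<in>supp_arcs Q M. polynomial_fun (\<lambda>s. snd (g s) a))"

lemma polynomial_fun_weight:
  assumes "polynomial_curve g" "v \<in> verts CQ"
  shows "polynomial_fun (\<lambda>s. weight (g s) v)"
  unfolding weight_eq
  using assms string_of_in_components arc_label_in_supp
  by (intro polynomial_fun_mult polynomial_fun_prod) (auto simp: polynomial_curve_def)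

text \<open>The vectors of a moved frame are combinations of basis vectors whose coefficients are
  weights times constants, and weights are products of torus coordinates. No division occurs, so the
  pullback is polynomial even at parameters where the curve is outside the torus.\<close>

lemma polynomial_fun_frame_poly:
  assumes g: "polynomial_curve g" and p: "p \<in> frame_polys Q M e"
  shows "polynomial_fun (\<lambda>s. p (torus_frame e (g s) F))"
  using p
proof induction
  case (coord i k \<phi>)
  interpret VC: vector_space_pair "rep_scale M" "(*) :: complex \<Rightarrow> complex \<Rightarrow> complex"
    by unfold_locales (auto simp: algebra_simps)
  have eq: "(\<lambda>s. \<phi> (torus_frame e (g s) F i k)) =
      (\<lambda>s. \<Sum>b\<in>B i. weight (g s) (i, b) * coord i (F i k) b * \<phi> b)"
    using coord
    by (simp add: torus_frame_def torus_map_def VC.linear_sum[OF coord(3)] VC.linear_scale[OF coord(3)])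
  show ?case
    unfolding eq using coord(1) g
    by (intro polynomial_fun_sum polynomial_fun_mult polynomial_fun_weight polynomial_fun_const)
      (simp_all add: verts_CQ)
qed (auto intro: polynomial_fun_const polynomial_fun_add polynomial_fun_mult)

text \<open>Two points of \<open>S\<close> lie on a rational curve, on which a product of polynomials can only vanish
  if one of the factors does.\<close>

lemma irreducible_torus_image:
  assumes U: "U \<in> Gr e" and S: "S \<subseteq> carrier torus" "S \<noteq> {}"
    and curve: "\<And>t1 t2. t1 \<in> S \<Longrightarrow> t2 \<in> S \<Longrightarrow> \<exists>g s1 s2. g s1 = t1 \<and> g s2 = t2 \<and>
      finite {s. g s \<notin> S} \<and> polynomial_curve g"
    and X: "X \<subseteq> Gr e" "(\<lambda>t. act e t U) ` S \<subseteq> X"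
  shows "irreducible_in (subtopology (quiver_grassmannian_zariski Q M e) X) ((\<lambda>t. act e t U) ` S)"
  unfolding irreducible_in_def topspace_orbit_zariski[OF X(1)] closedin_orbit_zariski[OF X(1)]
proof (intro conjI allI impI)
  let ?I = "(\<lambda>t. act e t U) ` S"
  show "?I \<subseteq> X" by (rule X(2))
  show "?I \<noteq> {}" using S(2) by simp
  fix Y Z
  assume "\<exists>Y'. zariski_closed Q M e Y' \<and> Y = Y' \<inter> X" "\<exists>Z'. zariski_closed Q M e Z' \<and> Z = Z' \<inter> X"
  then obtain Y' Z' where Y: "zariski_closed Q M e Y'" "Y = Y' \<inter> X"
    and Z: "zariski_closed Q M e Z'" "Z = Z' \<inter> X" by blast
  assume cover: "?I \<subseteq> Y \<union> Z"
  from Y(1) obtain P where P: "P \<subseteq> frame_polys Q M e"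
      "\<forall>W\<in>prod_grassmannian Q M e. \<forall>F\<in>frames Q M e W. W \<in> Y' \<longleftrightarrow> (\<forall>p\<in>P. p F = 0)"
    unfolding zariski_closed_def by (elim conjE exE)
  from Z(1) obtain R where R: "R \<subseteq> frame_polys Q M e"
      "\<forall>W\<in>prod_grassmannian Q M e. \<forall>F\<in>frames Q M e W. W \<in> Z' \<longleftrightarrow> (\<forall>p\<in>R. p F = 0)"
    unfolding zariski_closed_def by (elim conjE exE)
  obtain F where F: "F \<in> frames Q M e U" using frame_exists GrD(1)[OF U] by blast
  have tF: "act e t U \<in> prod_grassmannian Q M e" "torus_frame e t F \<in> frames Q M e (act e t U)"
    if "t \<in> S" for t
    using GrD(1)[OF act_closed[OF subsetD[OF S(1) that] U]] torus_frame_frames[OF subsetD[OF S(1) that] U F]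
    by simp_all
  show "?I \<subseteq> Y \<or> ?I \<subseteq> Z"
  proof (rule ccontr)
    assume "\<not> (?I \<subseteq> Y \<or> ?I \<subseteq> Z)"
    then obtain t1 t2 where t: "t1 \<in> S" "act e t1 U \<notin> Y'" "t2 \<in> S" "act e t2 U \<notin> Z'"
      using Y(2) Z(2) X(2) by blast
    obtain p where p: "p \<in> P" "p (torus_frame e t1 F) \<noteq> 0" using P(2)[rule_format, OF tF[OF t(1)]] t(2) by blast
    obtain r where r: "r \<in> R" "r (torus_frame e t2 F) \<noteq> 0" using R(2)[rule_format, OF tF[OF t(3)]] t(4) by blast
    obtain g s1 s2 where g: "g s1 = t1" "g s2 = t2" "finite {s. g s \<notin> S}" "polynomial_curve g"
      using curve[OF t(1,3)] by blast
    have "finite {s. p (torus_frame e (g s) F) = 0}"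
      using polynomial_fun_frame_poly[OF g(4)] P(1) p g(1) by (intro polynomial_fun_finite_zeros[of _ s1]) auto
    moreover have "finite {s. r (torus_frame e (g s) F) = 0}"
      using polynomial_fun_frame_poly[OF g(4)] R(1) r g(2) by (intro polynomial_fun_finite_zeros[of _ s2]) auto
    ultimately have "finite ({s. g s \<notin> S} \<union> {s. p (torus_frame e (g s) F) = 0} \<union>
        {s. r (torus_frame e (g s) F) = 0})"
      using g(3) by simp
    \<comment> \<open>Wherever the curve is in \<open>S\<close>, its point lies in \<open>Y\<close>
      or \<open>Z\<close>, so \<open>p\<close> or \<open>r\<close> vanishes there. Three finite sets
      would thus cover the complex numbers.\<close>
    moreover have "{s. g s \<notin> S} \<union> {s. p (torus_frame e (g s) F) = 0} \<union>
        {s. r (torus_frame e (g s) F) = 0} = UNIV"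
    proof -
      have "p (torus_frame e (g s) F) = 0 \<or> r (torus_frame e (g s) F) = 0" if "g s \<in> S" for s
        using cover that P(2)[rule_format, OF tF[OF that]] R(2)[rule_format, OF tF[OF that]] p(1) r(1) Y(2) Z(2) by blast
      then show ?thesis by blast
    qed
    ultimately show False using infinite_UNIV_char_0[where 'a = complex] by simp
  qed
qed

end


section \<open>Echelon forms\<close>

text \<open>As 2 is not a root of unity, this single parameter value separates all degrees of a
  one-parameter subgroup.\<close>

lemma two_power_inj: "(2 :: complex) ^ k = 2 ^ l \<longleftrightarrow> k = l"
proof
  assume "(2 :: complex) ^ k = 2 ^ l"
  then have "(of_nat (2 ^ k) :: complex) = of_nat (2 ^ l)" by simp
  then have "(2 :: nat) ^ k = 2 ^ l" by (simp only: of_nat_eq_iff)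
  then show "k = l" by (rule power_inject_exp[THEN iffD1, rotated]) simp
qed simp

context straight_rep
begin

text \<open>\<open>N\<close> consists of the non-pivot columns of a reduced echelon form of \<open>U i\<close>; the choice of pivots is
  not unique, as no order on \<open>B i\<close> is fixed.\<close>

definition pivot_free :: "'v \<Rightarrow> ('v \<Rightarrow> 'm set) \<Rightarrow> 'm set \<Rightarrow> bool" where
  "pivot_free i U N \<longleftrightarrow> N \<subseteq> B i \<and> U i \<inter> span N = {0} \<and> (\<forall>p\<in>B i - N. \<exists>u\<in>U i. u - p \<in> span N)"

definition echelon_row :: "'v \<Rightarrow> ('v \<Rightarrow> 'm set) \<Rightarrow> 'm set \<Rightarrow> 'm \<Rightarrow> 'm" where
  "echelon_row i U N p = (SOME u. u \<in> U i \<and> u - p \<in> span N)"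

abbreviation entry :: "'v \<Rightarrow> ('v \<Rightarrow> 'm set) \<Rightarrow> 'm set \<Rightarrow> 'm \<Rightarrow> 'm \<Rightarrow> complex" where
  "entry i U N p \<equiv> coord i (echelon_row i U N p)"

lemma span_coord:
  assumes i: "i \<in> verts Q" and N: "N \<subseteq> B i"
  shows "x \<in> span N \<longleftrightarrow> x \<in> rep_space M i \<and> (\<forall>b\<in>B i - N. coord i x b = 0)"
proof
  assume x: "x \<in> span N"
  have "coord i x = representation N x"
    using representation_extend[OF independent_B[OF i] x N] .
  then show "x \<in> rep_space M i \<and> (\<forall>b\<in>B i - N. coord i x b = 0)"
    using x span_mono[OF N] span_B[OF i] representation_ne_zero[of N x] by auto
next
  assume x: "x \<in> rep_space M i \<and> (\<forall>b\<in>B i - N. coord i x b = 0)"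
  have "x = (\<Sum>b\<in>B i. coord i x b *\<^sub>M b)" using coord_sum[OF i] x by simp
  also have "\<dots> \<in> span N"
  proof (rule span_sum)
    fix b assume "b \<in> B i"
    with x show "coord i x b *\<^sub>M b \<in> span N"
      by (cases "b \<in> N") (auto simp: span_zero intro: span_scale span_base)
  qed
  finally show "x \<in> span N" .
qed

text \<open>A maximal \<open>N\<close> with \<open>U i \<inter> span N = {0}\<close> works. Adding a
  further \<open>p\<close> makes the intersection nontrivial; an element of it has a nonzero
  coefficient \<open>k\<close> at \<open>p\<close>, since otherwise it would lie in
  \<open>span N\<close>, and dividing by \<open>k\<close> gives the row of \<open>p\<close>.\<close>

lemma pivot_free_exists:
  assumes i: "i \<in> verts Q" and U: "subspace (U i)"
  shows "\<exists>N. pivot_free i U N"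
proof -
  define \<N> where "\<N> = {N. N \<subseteq> B i \<and> U i \<inter> span N = {0}}"
  have "{} \<in> \<N>" using subspace_0[OF U] by (auto simp: \<N>_def)
  moreover have "finite \<N>"
    by (rule finite_subset[of _ "Pow (B i)"]) (auto simp: \<N>_def finite_B[OF i])
  ultimately obtain N where N: "N \<in> \<N>" "\<And>N'. N' \<in> \<N> \<Longrightarrow> N \<subseteq> N' \<Longrightarrow> N = N'"
    using finite_has_maximal[of \<N>] by blast
  have NB: "N \<subseteq> B i" and N0: "U i \<inter> span N = {0}" using N(1) unfolding \<N>_def by auto
  have "\<exists>u\<in>U i. u - p \<in> span N" if p: "p \<in> B i - N" for p
  proof -
    have "insert p N \<notin> \<N>" using N(2)[of "insert p N"] p by blast
    then have "U i \<inter> span (insert p N) \<noteq> {0}" using p NB by (auto simp: \<N>_def)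
    then obtain x where x: "x \<in> U i" "x \<in> span (insert p N)" "x \<noteq> 0"
      using subspace_0[OF U] span_zero by blast
    then obtain k where k: "x - k *\<^sub>M p \<in> span N" unfolding span_insert by blast
    have k0: "k \<noteq> 0"
    proof
      assume "k = 0"
      with k have "x \<in> span N" by simp
      with x N0 show False by blast
    qed
    have "inverse k *\<^sub>M (x - k *\<^sub>M p) = inverse k *\<^sub>M x - p"
      using k0 by (simp add: scale_right_diff_distrib)
    then show ?thesis
      using span_scale[OF k, of "inverse k"] subspace_scale[OF U x(1), of "inverse k"] by metis
  qed
  then show ?thesis using NB N0 unfolding pivot_free_def by blast
qed

lemma echelon_row:
  assumes "pivot_free i U N" "p \<in> B i - N"
  shows "echelon_row i U N p \<in> U i" "echelon_row i U N p - p \<in> span N"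
proof -
  have "\<exists>u. u \<in> U i \<and> u - p \<in> span N" using assms unfolding pivot_free_def by blast
  from someI_ex[OF this] show "echelon_row i U N p \<in> U i" "echelon_row i U N p - p \<in> span N"
    unfolding echelon_row_def by auto
qed

text \<open>Two candidates differ by an element of \<open>U i \<inter> span N = {0}\<close>, so the
  choice in \<open>echelon_row\<close> is no choice.\<close>

lemma echelon_row_eqI:
  assumes U: "subspace (U i)" and N: "pivot_free i U N" "p \<in> B i - N"
    and u: "u \<in> U i" "u - p \<in> span N"
  shows "echelon_row i U N p = u"
proof -
  have "echelon_row i U N p - u \<in> U i"
    using subspace_diff[OF U echelon_row(1)[OF N] u(1)] .
  moreover have "echelon_row i U N p - u \<in> span N"
    using span_diff[OF echelon_row(2)[OF N] u(2)] by simp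
  ultimately have "echelon_row i U N p - u \<in> {0}" using N(1) unfolding pivot_free_def by blast
  then show ?thesis by simp
qed

lemma echelon_row_iff:
  assumes i: "i \<in> verts Q" and U: "subspace (U i)" "U i \<subseteq> rep_space M i"
    and N: "pivot_free i U N" "p \<in> B i - N"
  shows "echelon_row i U N p = u \<longleftrightarrow>
    u \<in> U i \<and> coord i u p = 1 \<and> (\<forall>b\<in>B i - N - {p}. coord i u b = 0)"
proof -
  have NB: "N \<subseteq> B i" using N(1) unfolding pivot_free_def by blast
  have p: "p \<in> B i" "p \<in> rep_space M i" using N(2) B_in_space[OF i] by auto
  have "u \<in> U i \<and> u - p \<in> span N \<longleftrightarrow>
      u \<in> U i \<and> coord i u p = 1 \<and> (\<forall>b\<in>B i - N - {p}. coord i u b = 0)" for u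
  proof (cases "u \<in> U i")
    case True
    then have u: "u \<in> rep_space M i" using U by blast
    have "u - p \<in> span N \<longleftrightarrow> (\<forall>b\<in>B i - N. coord i u b - (if b = p then 1 else 0) = 0)"
      using span_coord[OF i NB] u p i by (simp add: coord_diff coord_basis subspace_diff[OF rep_subspace])
    also have "\<dots> \<longleftrightarrow> coord i u p = 1 \<and> (\<forall>b\<in>B i - N - {p}. coord i u b = 0)"
      using N(2) by auto
    finally show ?thesis using True by blast
  qed blast
  then show ?thesis
    using echelon_row[OF N] echelon_row_eqI[OF U(1) N] by metis
qed

text \<open>The rows span \<open>U i\<close>: subtracting from \<open>x\<close> the rows weighted by
  its pivot coordinates leaves an element of \<open>U i \<inter> span N\<close>, hence zero.
  Equality of the two spaces follows by exchanging their roles.\<close>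

lemma subspace_eq_if_rows_eq:
  assumes i: "i \<in> verts Q"
    and U: "subspace (U i)" "U i \<subseteq> rep_space M i" "pivot_free i U N"
    and W: "subspace (W i)" "pivot_free i W N"
    and rows: "\<And>p. p \<in> B i - N \<Longrightarrow> echelon_row i U N p = echelon_row i W N p"
  shows "U i \<subseteq> W i"
proof
  fix x assume x: "x \<in> U i"
  have NB: "N \<subseteq> B i" and N0: "U i \<inter> span N = {0}" using U(3) unfolding pivot_free_def by auto
  note xs = subsetD[OF U(2) x]
  define y where "y = (\<Sum>p\<in>B i - N. coord i x p *\<^sub>M echelon_row i U N p)"
  have rU: "echelon_row i U N p \<in> U i" if "p \<in> B i - N" for p
    using echelon_row(1)[OF U(3) that] .
  have y: "y \<in> U i" unfolding y_def using rU by (intro subspace_sum[OF U(1)] subspace_scale[OF U(1)])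
  have "coord i y b = coord i x b" if b: "b \<in> B i - N" for b
  proof -
    have r: "coord i (echelon_row i U N p) b = (if p = b then 1 else 0)" if "p \<in> B i - N" for p
      using echelon_row_iff[OF i U that, of "echelon_row i U N p"] b by auto
    have "coord i y b = (\<Sum>p\<in>B i - N. coord i x p * coord i (echelon_row i U N p) b)"
      unfolding y_def using rU U(2) i
      by (subst representation_sum)
        (auto simp: independent_B span_B coord_scale subsetD intro!: subspace_scale[OF rep_subspace] sum.cong)
    also have "\<dots> = (\<Sum>p\<in>B i - N. if p = b then coord i x p else 0)"
      by (rule sum.cong) (use r in auto)
    also have "\<dots> = coord i x b" using b finite_B[OF i] by simp
    finally show ?thesis .
  qed
  then have "x - y \<in> span N"
    using span_coord[OF i NB, of "x - y"] xs y U(2) i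
    by (auto simp: coord_diff subsetD intro: subspace_diff[OF rep_subspace])
  then have "x - y \<in> {0}" using N0 subspace_diff[OF U(1) x y] by blast
  then have "x = y" by simp
  also have "y \<in> W i"
    unfolding y_def using rows echelon_row(1)[OF W(2)]
    by (intro subspace_sum[OF W(1)] subspace_scale[OF W(1)]) auto
  finally show "x \<in> W i" .
qed

text \<open>The torus is diagonal in the basis with nonzero weights, so it preserves
  \<open>span N\<close>. Dividing the image of a row by the weight of its pivot restores the pivot
  coordinate 1, and uniqueness identifies the result as the new row.\<close>

lemma act_echelon:
  assumes t: "t \<in> carrier torus" and U: "U \<in> Gr e" and i: "i \<in> verts Q" and N: "pivot_free i U N"
  shows "pivot_free i (act e t U) N"
    and "p \<in> B i - N \<Longrightarrow> q \<in> B i \<Longrightarrow>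
      entry i (act e t U) N p q = weight t (i, q) / weight t (i, p) * entry i U N p q"
proof -
  have NB: "N \<subseteq> B i" and N0: "U i \<inter> span N = {0}" using N unfolding pivot_free_def by auto
  note Ui = GrD(3)[OF U i] GrD(4)[OF U i]
  note tU = act_closed[OF t U]
  note tUi = GrD(3)[OF tU i] GrD(4)[OF tU i]
  have w: "weight t (i, b) \<noteq> 0" if "b \<in> B i" for b
    using weight_nonzero[OF t] that i by (simp add: verts_CQ)
  define r where "r = (\<lambda>p. inverse (weight t (i, p)) *\<^sub>M tmap t i (echelon_row i U N p))"
  have rin: "r p \<in> act e t U i" and rc: "b \<in> B i \<Longrightarrow>
      coord i (r p) b = weight t (i, b) / weight t (i, p) * entry i U N p b"
    if p: "p \<in> B i - N" for p b
  proof -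
    have "tmap t i (echelon_row i U N p) \<in> act e t U i"
      using echelon_row(1)[OF N p] act_apply[OF U i] by blast
    then show "r p \<in> act e t U i" unfolding r_def by (rule subspace_scale[OF tUi(1)])
    show "coord i (r p) b = weight t (i, b) / weight t (i, p) * entry i U N p b" if "b \<in> B i"
      using that i by (simp add: r_def coord_scale tmap_closed coord_tmap field_simps)
  qed
  have rp: "coord i (r p) p = 1 \<and> (\<forall>b\<in>B i - N - {p}. coord i (r p) b = 0)" if p: "p \<in> B i - N" for p
    using echelon_row_iff[OF i Ui N p, of "echelon_row i U N p"] rc[OF p] w p by auto
  show pf: "pivot_free i (act e t U) N"
    unfolding pivot_free_def
  proof (intro conjI ballI)
    show "act e t U i \<inter> span N = {0}"
    proof -
      have "x = 0" if x: "x \<in> act e t U i" "x \<in> span N" for x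
      proof -
        obtain u where u: "u \<in> U i" "x = tmap t i u" using x(1) act_apply[OF U i] by auto
        have "u \<in> span N"
          using x(2) u(1) Ui(2) i w by (auto simp: span_coord[OF i NB] u(2) coord_tmap)
        then have "u = 0" using u(1) N0 by blast
        then show ?thesis using u(2) by (simp add: tmap_zero)
      qed
      then show ?thesis using subspace_0[OF tUi(1)] span_zero by blast
    qed
    fix p assume p: "p \<in> B i - N"
    have "r p - p \<in> span N"
      using rp[OF p] p rin[OF p] tUi(2) i B_in_space[OF i]
      by (auto simp: span_coord[OF i NB] coord_diff coord_basis subsetD subspace_diff[OF rep_subspace])
    then show "\<exists>u\<in>act e t U i. u - p \<in> span N" using rin[OF p] by blast
  qed (rule NB)
  assume p: "p \<in> B i - N" and q: "q \<in> B i"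
  have "echelon_row i (act e t U) N p = r p"
    using echelon_row_iff[OF i tUi pf p] rin[OF p] rp[OF p] by blast
  then show "entry i (act e t U) N p q = weight t (i, q) / weight t (i, p) * entry i U N p q"
    using rc[OF p q] by simp
qed

text \<open>Among the subspaces with non-pivots \<open>N\<close>, those whose \<open>(p, q)\<close> entry is \<open>\<kappa>\<close>; see \<open>entry_locus_iff\<close>.\<close>

definition entry_locus where
  "entry_locus e i N p q \<kappa> =
    {W \<in> prod_grassmannian Q M e. W i \<inter> span (insert (p + \<kappa> *\<^sub>M q) (N - {q})) \<noteq> {0}}"

text \<open>An instance of \<open>zariski_closed_meet\<close>: the new vector has coordinate 1 at
  \<open>p\<close>, which is not in \<open>N\<close>, so it is independent of the rest.\<close>

lemma zariski_closed_entry_locus: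
  assumes i: "i \<in> verts Q" and N: "N \<subseteq> B i" and p: "p \<in> B i - N" and q: "q \<in> N"
  shows "zariski_closed Q M e (entry_locus e i N p q \<kappa>)"
  unfolding entry_locus_def
proof (rule zariski_closed_meet[OF i])
  show "finite (insert (p + \<kappa> *\<^sub>M q) (N - {q}))" using finite_subset[OF N finite_B[OF i]] by simp
  have pq: "p \<in> B i" "q \<in> B i" "p \<in> rep_space M i" "q \<in> rep_space M i" using p q N B_in_space[OF i] by auto
  then have "coord i (p + \<kappa> *\<^sub>M q) p = 1"
    using p q N i by (auto simp: coord_add coord_scale coord_basis subspace_scale[OF rep_subspace])
  then have "p + \<kappa> *\<^sub>M q \<notin> span (N - {q})"
    using span_coord[OF i, of "N - {q}"] N p by fastforce
  then show "independent (insert (p + \<kappa> *\<^sub>M q) (N - {q}))"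
    using independent_mono[OF independent_B[OF i], of "N - {q}"] N by (intro independent_insertI) auto
qed

text \<open>A nonzero element of the intersection must involve \<open>p + \<kappa> q\<close>, as
  otherwise it would lie in \<open>W i \<inter> span N\<close>. After normalisation it is the row of
  \<open>p\<close>, and its coordinate at \<open>q\<close> is \<kappa> because \<open>q\<close>
  itself has been removed from the span.\<close>

lemma entry_locus_iff:
  assumes W: "W \<in> Gr e" and i: "i \<in> verts Q" and N: "pivot_free i W N"
    and p: "p \<in> B i - N" and q: "q \<in> N"
  shows "W \<in> entry_locus e i N p q \<kappa> \<longleftrightarrow> entry i W N p q = \<kappa>"
proof -
  have NB: "N \<subseteq> B i" and N0: "W i \<inter> span N = {0}" using N unfolding pivot_free_def by auto
  note Wi = GrD(3)[OF W i] GrD(4)[OF W i]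
  have pq: "p \<in> B i" "q \<in> B i" "p \<in> rep_space M i" "q \<in> rep_space M i" "p \<noteq> q"
    using p q NB B_in_space[OF i] by auto
  let ?v = "p + \<kappa> *\<^sub>M q"
  have v: "?v \<in> rep_space M i" "\<And>b. coord i ?v b = (if b = p then 1 else 0) + \<kappa> * (if b = q then 1 else 0)"
    using pq i by (auto simp: coord_add coord_scale coord_basis subspace_scale[OF rep_subspace]
        intro: subspace_add[OF rep_subspace])
  have NqB: "N - {q} \<subseteq> B i" using NB by blast
  show ?thesis
  proof
    assume "W \<in> entry_locus e i N p q \<kappa>"
    then obtain x where x: "x \<in> W i" "x \<in> span (insert ?v (N - {q}))" "x \<noteq> 0"
      unfolding entry_locus_def using subspace_0[OF Wi(1)] span_zero by blast
    then obtain k where k: "x - k *\<^sub>M ?v \<in> span (N - {q})" unfolding span_insert by blast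
    have xs: "x \<in> rep_space M i" using x(1) Wi(2) by blast
    have cx: "coord i x b = k * coord i ?v b" if "b \<in> B i - (N - {q})" for b
    proof -
      have "coord i (x - k *\<^sub>M ?v) b = 0" using k that span_coord[OF i NqB] by blast
      then show ?thesis
        using xs v(1) i by (simp add: coord_diff coord_scale subspace_scale[OF rep_subspace])
    qed
    have k0: "k \<noteq> 0"
    proof
      assume "k = 0"
      then have "x \<in> span N" using cx xs by (auto simp: span_coord[OF i NB])
      with x N0 show False by blast
    qed
    have "echelon_row i W N p = inverse k *\<^sub>M x"
      unfolding echelon_row_iff[OF i Wi N p]
      using k0 cx x(1) xs i v(2) pq p q
      by (auto simp: coord_scale intro: subspace_scale[OF Wi(1)])
    then show "entry i W N p q = \<kappa>"
      using k0 cx[of q] xs i v(2) pq by (simp add: coord_scale)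
  next
    assume \<kappa>: "entry i W N p q = \<kappa>"
    let ?r = "echelon_row i W N p"
    have r: "?r \<in> W i" "coord i ?r p = 1" "\<And>b. b\<in>B i - N - {p} \<Longrightarrow> coord i ?r b = 0"
      using echelon_row_iff[OF i Wi N p, of ?r] by auto
    have "?r - 1 *\<^sub>M ?v \<in> span (N - {q})"
      using r Wi(2) v i \<kappa> pq
      by (auto simp: span_coord[OF i NqB] coord_diff subsetD intro!: subspace_diff[OF rep_subspace])
    then have "?r \<in> span (insert ?v (N - {q}))" unfolding span_insert by blast
    moreover have "?r \<noteq> 0" using r(2) by (auto simp: representation_zero)
    ultimately show "W \<in> entry_locus e i N p q \<kappa>"
      using r(1) GrD(1)[OF W] unfolding entry_locus_def by blast
  qed
qed

section \<open>One-parameter subgroups\<close>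

text \<open>Giving all arrows of the quiver the same exponent loses nothing: in a string, the basis vectors
  still have pairwise different weights.\<close>

definition one_param ::
  "(('v \<times> 'm, 'a \<times> 'm \<times> 'm) pre_digraph \<Rightarrow> nat) \<Rightarrow> nat \<Rightarrow> complex \<Rightarrow>
    (('v \<times> 'm, 'a \<times> 'm \<times> 'm) pre_digraph \<Rightarrow> complex) \<times> ('a \<Rightarrow> complex)" where
  "one_param n m \<tau> = (\<lambda>C\<in>components CQ. \<tau> ^ n C, \<lambda>a\<in>supp_arcs Q M. \<tau> ^ m)"

text \<open>The exponent of the weight along \<open>one_param\<close>. Natural exponents keep that
  curve polynomial, including at the parameter 0.\<close>

definition wt_degree :: "(('v \<times> 'm, 'a \<times> 'm \<times> 'm) pre_digraph \<Rightarrow> nat) \<Rightarrow> nat \<Rightarrow> 'v \<times> 'm \<Rightarrow> nat" where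
  "wt_degree n m v = n (string_of v) + m * height v"

lemma one_param_carrier: "\<tau> \<noteq> 0 \<Longrightarrow> one_param n m \<tau> \<in> carrier torus"
  by (auto simp: one_param_def carrier_torus)

lemma one_param_one: "one_param n m 1 = \<one>\<^bsub>torus\<^esub>"
  by (simp add: one_param_def torus_one)

lemma weight_one_param: "v \<in> verts CQ \<Longrightarrow> weight (one_param n m \<tau>) v = \<tau> ^ wt_degree n m v"
  using string_of_in_components arc_label_in_supp
  by (simp add: one_param_def weight_eq wt_degree_def height_def power_add power_mult)

lemma polynomial_curve_one_param: "polynomial_curve (one_param n m)"
  unfolding polynomial_curve_def one_param_def
  by (auto intro: polynomial_fun_power polynomial_fun_ident)

lemma finite_components: "finite (components CQ)"
proof (rule finite_subset)
  show "components CQ \<subseteq> string_of ` verts CQ"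
    by (auto elim: CQ.component_eqE)
qed simp

lemma finite_supp_arcs: "finite (supp_arcs Q M)"
  by (rule finite_subset[of _ "arcs Q"]) (auto simp: supp_arcs_def)

text \<open>The affine line through \<open>t1\<close> and \<open>t2\<close>. Each coordinate is
  nonzero at parameter 0, so it vanishes at finitely many parameters, and there are finitely many
  coordinates.\<close>

lemma torus_line:
  assumes t: "t1 \<in> carrier torus" "t2 \<in> carrier torus"
  shows "\<exists>g s1 s2. g s1 = t1 \<and> g s2 = t2 \<and> finite {s. g s \<notin> carrier torus} \<and> polynomial_curve g"
proof -
  define h :: "complex \<Rightarrow> complex \<Rightarrow> complex \<Rightarrow> complex" where "h = (\<lambda>x y s. x + s * (y + (-1) * x))"
  define g where "g = (\<lambda>s. (\<lambda>C\<in>components CQ. h (fst t1 C) (fst t2 C) s,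
    \<lambda>a\<in>supp_arcs Q M. h (snd t1 a) (snd t2 a) s))"
  have h: "polynomial_fun (h x y)" for x y
    unfolding h_def
    by (intro polynomial_fun_add polynomial_fun_mult polynomial_fun_const polynomial_fun_ident)
  have fin: "finite {s. h x y s = 0}" if "x \<noteq> 0" for x y
    by (rule polynomial_fun_finite_zeros[OF h, of _ _ 0]) (simp add: h_def that)
  have ext: "fst t \<in> extensional (components CQ)" "snd t \<in> extensional (supp_arcs Q M)"
    if "t \<in> carrier torus" for t
    using that by (auto simp: carrier_torus PiE_iff)
  have "g 0 = t1" "g 1 = t2"
    using ext t by (simp_all add: g_def h_def extensional_restrict)
  moreover have "finite {s. g s \<notin> carrier torus}"
  proof (rule finite_subset)
    show "{s. g s \<notin> carrier torus} \<subseteq> (\<Union>C\<in>components CQ. {s. h (fst t1 C) (fst t2 C) s = 0}) \<union>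
        (\<Union>a\<in>supp_arcs Q M. {s. h (snd t1 a) (snd t2 a) s = 0})"
      by (auto simp: carrier_torus g_def)
    show "finite ((\<Union>C\<in>components CQ. {s. h (fst t1 C) (fst t2 C) s = 0}) \<union>
        (\<Union>a\<in>supp_arcs Q M. {s. h (snd t1 a) (snd t2 a) s = 0}))"
      using t by (auto simp: finite_components finite_supp_arcs carrier_torus PiE_iff intro!: fin)
  qed
  moreover have "polynomial_curve g"
    using h by (simp add: polynomial_curve_def g_def)
  ultimately show ?thesis by blast
qed

text \<open>The level set of the entry at \<open>(p', q')\<close> contains the point but not the
  orbit of the subgroup; the level set of the entry at \<open>(p, q)\<close> contains the latter
  but, by \<open>cross\<close>, not the whole orbit.\<close>

lemma krull_dim_orbit_ne_1:
  assumes U: "U \<in> Gr e"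
    and N: "i \<in> verts Q" "pivot_free i U N" "p \<in> B i - N" "q \<in> N" "entry i U N p q \<noteq> 0"
    and N': "i' \<in> verts Q" "pivot_free i' U N'" "p' \<in> B i' - N'" "q' \<in> N'" "entry i' U N' p' q' \<noteq> 0"
    and cross: "string_of (i, p) \<noteq> string_of (i, q)"
    and deg: "wt_degree n m (i, p) = wt_degree n m (i, q)" "wt_degree n m (i', p') \<noteq> wt_degree n m (i', q')"
  shows "krull_dim (subtopology (quiver_grassmannian_zariski Q M e) (Group_Action.orbit torus (act e) U)) \<noteq> 1"
proof -
  let ?f = "\<lambda>t. act e t U"
  let ?X = "Group_Action.orbit torus (act e) U"
  let ?T = "subtopology (quiver_grassmannian_zariski Q M e) ?X"
  let ?S1 = "one_param n m ` (- {0})"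
  have X: "?X = ?f ` carrier torus" unfolding Group_Action.orbit_def by blast
  have XGr: "?X \<subseteq> Gr e" unfolding X using act_closed U by blast
  have S1: "?S1 \<subseteq> carrier torus" using one_param_carrier by blast
  have one: "\<one>\<^bsub>torus\<^esub> \<in> ?S1" using one_param_one by (intro image_eqI[of _ _ 1]) auto
  have NB: "N \<subseteq> B i" "q \<in> B i" "N' \<subseteq> B i'" "q' \<in> B i'" using N N' unfolding pivot_free_def by auto
  have V: "(i, p) \<in> verts CQ" "(i, q) \<in> verts CQ" "(i', p') \<in> verts CQ" "(i', q') \<in> verts CQ"
    using N N' NB by (auto simp: verts_CQ)
  define Y where "Y = entry_locus e i N p q (entry i U N p q)"
  define Y' where "Y' = entry_locus e i' N' p' q' (entry i' U N' p' q')"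
  \<comment> \<open>The entry is multiplied by a ratio of weights and is nonzero, so it is unchanged
    exactly if the two weights agree.\<close>
  have Y: "?f t \<in> Y \<longleftrightarrow> weight t (i, p) = weight t (i, q)" if t: "t \<in> carrier torus" for t
    using entry_locus_iff[OF act_closed[OF t U] N(1) act_echelon(1)[OF t U N(1,2)] N(3,4)]
      act_echelon(2)[OF t U N(1,2,3) NB(2)] N(5) weight_nonzero[OF t V(1)]
    unfolding Y_def by (auto simp: field_simps)
  have Y': "?f t \<in> Y' \<longleftrightarrow> weight t (i', p') = weight t (i', q')" if t: "t \<in> carrier torus" for t
    using entry_locus_iff[OF act_closed[OF t U] N'(1) act_echelon(1)[OF t U N'(1,2)] N'(3,4)]
      act_echelon(2)[OF t U N'(1,2,3) NB(4)] N'(5) weight_nonzero[OF t V(3)]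
    unfolding Y'_def by (auto simp: field_simps)
  have closed: "closedin ?T (Y \<inter> ?X)" "closedin ?T (Y' \<inter> ?X)"
    unfolding closedin_orbit_zariski[OF XGr] Y_def Y'_def
    using zariski_closed_entry_locus[OF N(1) NB(1) N(3,4)]
      zariski_closed_entry_locus[OF N'(1) NB(3) N'(3,4)] by blast+
  show ?thesis
  proof (rule krull_dim_ne_1[where ?Y1.0 = "Y' \<inter> ?X" and ?Y2.0 = "Y \<inter> ?X"])
    show "irreducible_in ?T (?f ` {\<one>\<^bsub>torus\<^esub>})"
    proof (rule irreducible_torus_image[OF U])
      fix t1 t2 assume "t1 \<in> {\<one>\<^bsub>torus\<^esub>}" "t2 \<in> {\<one>\<^bsub>torus\<^esub>}"
      then show "\<exists>g s1 s2. g s1 = t1 \<and> g s2 = t2 \<and> finite {s. g s \<notin> {\<one>\<^bsub>torus\<^esub>}} \<and> polynomial_curve g"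
        by (intro exI[of _ "\<lambda>s :: complex. \<one>\<^bsub>torus\<^esub>"])
          (auto simp: polynomial_curve_def intro: polynomial_fun_const)
    qed (use one S1 XGr X in auto)
    show "irreducible_in ?T (?f ` ?S1)"
    proof (rule irreducible_torus_image[OF U S1])
      fix t1 t2 assume "t1 \<in> ?S1" "t2 \<in> ?S1"
      then obtain s1 s2 where "one_param n m s1 = t1" "one_param n m s2 = t2" by auto
      moreover have "finite {s. one_param n m s \<notin> ?S1}"
        by (rule finite_subset[of _ "{0}"]) blast+
      ultimately show "\<exists>g s1 s2. g s1 = t1 \<and> g s2 = t2 \<and> finite {s. g s \<notin> ?S1} \<and> polynomial_curve g"
        using polynomial_curve_one_param by blast
    qed (use one S1 XGr X in auto)
    show "irreducible_in ?T (?f ` carrier torus)"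
      by (rule irreducible_torus_image[OF U _ _ torus_line]) (use one S1 XGr X in auto)
    show "?f ` {\<one>\<^bsub>torus\<^esub>} \<subseteq> ?f ` ?S1" using one by blast
    show "?f ` ?S1 \<subseteq> ?f ` carrier torus" using S1 by blast
    show "closedin ?T (Y \<inter> ?X)" "closedin ?T (Y' \<inter> ?X)" by (fact closed)+
    have "?f \<one>\<^bsub>torus\<^esub> \<in> Y'" using Y'[OF subsetD[OF S1 one]] weight_one V by simp
    then show "?f ` {\<one>\<^bsub>torus\<^esub>} \<subseteq> Y' \<inter> ?X" using X S1 one by auto
    have "?f (one_param n m 2) \<notin> Y'"
      using Y'[OF one_param_carrier, of 2] V deg(2) by (simp add: weight_one_param two_power_inj)
    moreover have "?f (one_param n m 2) \<in> ?f ` ?S1" by (intro imageI) simp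
    ultimately show "\<not> ?f ` ?S1 \<subseteq> Y' \<inter> ?X" by blast
    have "?f (one_param n m \<tau>) \<in> Y" if "\<tau> \<noteq> 0" for \<tau>
      using Y[OF one_param_carrier[OF that]] V deg(1) by (simp add: weight_one_param)
    then show "?f ` ?S1 \<subseteq> Y \<inter> ?X" using X S1 by blast
    \<comment> \<open>Scaling the string of \<open>q\<close> alone by 2 doubles the entry, because
      \<open>p\<close> lies in another string.\<close>
    let ?t = "one_param (\<lambda>C. if C = string_of (i, q) then 1 else 0) 0 2"
    have "?f ?t \<notin> Y"
      using Y[OF one_param_carrier, of 2] V cross by (simp add: weight_one_param wt_degree_def)
    moreover have "?f ?t \<in> ?f ` carrier torus" by (intro imageI one_param_carrier) simp
    ultimately show "\<not> ?f ` carrier torus \<subseteq> Y \<inter> ?X" by blast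
  qed
qed

end


section \<open>Walks inside a subrepresentation\<close>

context straight_rep
begin

lemma arc_in_subrep:
  assumes U: "U \<in> Gr e" and \<alpha>: "(a, x, y) \<in> arcs CQ" and x: "x \<in> U (tail Q a)"
  shows "y \<in> U (head Q a)"
proof -
  let ?c = "coord (head Q a) (rep_map M a x) y"
  from \<alpha> have a: "a \<in> arcs Q" "?c \<noteq> 0" by (auto simp: arcs_CQ)
  have j: "head Q a \<in> verts Q" using a by simp
  have "?c *\<^sub>M y \<in> U (head Q a)"
    using GrD(6)[OF U a(1) x] by (simp only: rep_map_arc[OF \<alpha>, symmetric])
  then have "inverse ?c *\<^sub>M ?c *\<^sub>M y \<in> U (head Q a)"
    by (rule subspace_scale[OF GrD(3)[OF U j]])
  then show ?thesis using a(2) by simp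
qed

lemma arcs_ends_CQ:
  assumes "(v, w) \<in> arcs_ends CQ"
  obtains a x y where "(a, x, y) \<in> arcs CQ" "v = (tail Q a, x)" "w = (head Q a, y)"
  using assms by (auto simp: arcs_ends_conv)

lemma walk_in_subrep:
  assumes U: "U \<in> Gr e" and vw: "(v, w) \<in> arcs_ends CQ ^^ k" and v: "snd v \<in> U (fst v)"
  shows "snd w \<in> U (fst w)"
  using vw
proof (induction k arbitrary: w)
  case (Suc k)
  then obtain y where y: "(v, y) \<in> arcs_ends CQ ^^ k" "(y, w) \<in> arcs_ends CQ" by auto
  from y(2) show ?case
    by (rule arcs_ends_CQ) (use arc_in_subrep[OF U] Suc.IH[OF y(1)] in auto)
qed (use v in simp)

text \<open>Later visits of the same string to the same vertex of \<open>Q\<close>; they exist only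
  if the string runs through an oriented cycle.\<close>

definition above :: "'v \<times> 'm \<Rightarrow> 'm set" where
  "above v = {b \<in> B (fst v). string_of (fst v, b) = string_of v \<and> height v < height (fst v, b)}"

lemma rep_map_above:
  assumes \<alpha>: "(a, x, y) \<in> arcs CQ" and b: "b \<in> above (tail Q a, x)"
  shows "rep_map M a b \<in> span (above (head Q a, y))"
proof (cases "\<exists>z. (a, b, z) \<in> arcs CQ")
  case True
  then obtain z where z: "(a, b, z) \<in> arcs CQ" by blast
  have "z \<in> above (head Q a, y)"
    using b z height_step[OF z] height_step[OF \<alpha>] CQ.component_of_arc(1)[OF z] CQ.component_of_arc(1)[OF \<alpha>]
    by (simp add: above_def arcs_CQ)
  then show ?thesis
    by (subst rep_map_arc[OF z]) (intro span_scale span_base)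
next
  case False
  then have "rep_map M a b = 0"
    using \<alpha> b by (intro rep_map_no_arc) (auto simp: arcs_CQ above_def)
  then show ?thesis by (simp add: span_zero)
qed

text \<open>Induction from the end of the string. At the end \<open>above v\<close> is empty.
  Otherwise the arrow leaving \<open>v\<close> sends the given vector to one of the same form with
  leading vertex \<open>w\<close>, the successor of \<open>v\<close>, so \<open>w\<close> is in the
  subrepresentation; walking on from \<open>w\<close> puts all of \<open>above v\<close> there, and
  the tail \<open>y\<close> can be subtracted.\<close>

lemma uniserial_step:
  assumes U: "U \<in> Gr e" and v: "v \<in> verts CQ" and c: "c \<noteq> 0"
    and y: "y \<in> span (above v)" and x: "c *\<^sub>M snd v + y \<in> U (fst v)"
  shows "snd v \<in> U (fst v)"
  using v c y x
proof (induction "card (arcs CQ) - height v" arbitrary: v c y rule: less_induct)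
  case less
  obtain i b where v: "v = (i, b)" by (cases v)
  have i: "i \<in> verts Q" and b: "b \<in> B i" using less.prems(1) by (auto simp: v verts_CQ)
  have aboveB: "above v \<subseteq> B i" "finite (above v)"
    using finite_subset[OF _ finite_B[OF i], of "above v"] by (auto simp: above_def v)
  have "above v \<subseteq> U i"
  proof (cases "\<exists>w. (v, w) \<in> arcs_ends CQ")
    case False
    have "above v = {}"
    proof (rule ccontr)
      assume "above v \<noteq> {}"
      then obtain d where d: "d \<in> B i" "string_of (i, d) = string_of v" "height v < height (i, d)"
        by (auto simp: above_def v)
      from d(3) obtain k where "height (i, d) = height v + Suc k"
        by (metis less_iff_Suc_add add_Suc_right)
      from string_walk_height[OF less.prems(1) _ d(2)[symmetric] this] d(1) i
      have "(v, (i, d)) \<in> arcs_ends CQ ^^ Suc k" by (simp add: verts_CQ)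
      then show False using False relpow_Suc_D2 by metis
    qed
    then show ?thesis by simp
  next
    case True
    then obtain w where "(v, w) \<in> arcs_ends CQ" by blast
    then obtain a z where \<alpha>: "(a, b, z) \<in> arcs CQ" and i': "i = tail Q a" and w: "w = (head Q a, z)"
      by (rule arcs_ends_CQ) (auto simp: v)
    have a: "a \<in> arcs Q" and wV: "w \<in> verts CQ" using \<alpha> by (auto simp: arcs_CQ verts_CQ w)
    have hw: "height w = Suc (height v)" "string_of w = string_of v"
      using height_step[OF \<alpha>] CQ.component_of_arc(1)[OF \<alpha>] by (simp_all add: v w i')
    have "height w \<le> card (arcs CQ)"
      unfolding height_def by (rule card_mono) auto
    then have dec: "card (arcs CQ) - height w < card (arcs CQ) - height v" using hw(1) by simp
    let ?c = "coord (head Q a) (rep_map M a b) z"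
    have c: "c * ?c \<noteq> 0" using less.prems(2) \<alpha> by (simp add: arcs_CQ)
    obtain r where r: "y = (\<Sum>d\<in>above v. r d *\<^sub>M d)"
      using less.prems(3) aboveB(2) by (auto simp: span_finite)
    have sp: "d \<in> rep_space M (tail Q a)" if "d \<in> above v \<or> d = b" for d
      using that aboveB(1) b B_in_space[OF i] i' by auto
    have My: "rep_map M a y = (\<Sum>d\<in>above v. r d *\<^sub>M rep_map M a d)"
      unfolding r using sp a
      by (simp add: rep_map_sum rep_map_scale subspace_scale[OF rep_subspace])
    have "rep_map M a y \<in> span (above w)"
      unfolding My w using rep_map_above[OF \<alpha>] by (intro span_sum span_scale) (simp add: v i')
    moreover have "rep_map M a (c *\<^sub>M b + y) = (c * ?c) *\<^sub>M z + rep_map M a y"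
    proof -
      have "y \<in> rep_space M (tail Q a)"
        unfolding r using sp a by (intro subspace_sum[OF rep_subspace] subspace_scale[OF rep_subspace]) auto
      then have "rep_map M a (c *\<^sub>M b + y) = c *\<^sub>M rep_map M a b + rep_map M a y"
        using sp[of b] a by (simp add: rep_map_add rep_map_scale subspace_scale[OF rep_subspace])
      also have "rep_map M a b = ?c *\<^sub>M z" by (rule rep_map_arc[OF \<alpha>])
      finally show ?thesis by simp
    qed
    then have "(c * ?c) *\<^sub>M z + rep_map M a y \<in> U (head Q a)"
      using GrD(6)[OF U a] less.prems(4) by (metis fst_conv snd_conv v i')
    ultimately have "snd w \<in> U (fst w)"
      using less.hyps[OF dec wV c] by (simp add: w)
    \<comment> \<open>A later vertex of the string than \<open>v\<close> is \<open>w\<close> itself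
      or is reached from \<open>w\<close>.\<close>
    have "d \<in> U i" if d: "d \<in> above v" for d
    proof -
      have "height w \<le> height (i, d)" "string_of w = string_of (i, d)" "(i, d) \<in> verts CQ"
        using d hw aboveB(1) i by (auto simp: above_def v verts_CQ)
      then obtain k where "(w, (i, d)) \<in> arcs_ends CQ ^^ k"
        using string_walk_height[OF wV] le_Suc_ex by blast
      from walk_in_subrep[OF U this \<open>snd w \<in> U (fst w)\<close>] show ?thesis by simp
    qed
    then show ?thesis by blast
  qed
  then have "y \<in> U i" using span_minimal[OF _ GrD(3)[OF U i]] less.prems(3) by blast
  then have "(c *\<^sub>M b + y) - y \<in> U i"
    by (rule subspace_diff[OF GrD(3)[OF U i], rotated]) (use less.prems(4) in \<open>simp add: v\<close>)
  then have "c *\<^sub>M b \<in> U i" by simp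
  then have "inverse c *\<^sub>M c *\<^sub>M b \<in> U i" by (rule subspace_scale[OF GrD(3)[OF U i]])
  then show ?case using less.prems(2) by (simp add: v)
qed

text \<open>The basis vector of least height in the support serves as leading term for
  \<open>uniserial_step\<close>; every other one is reached from it by a walk.\<close>

lemma uniserial_support:
  assumes U: "U \<in> Gr e" and i: "i \<in> verts Q" and x: "x \<in> U i"
    and C: "\<And>b. b \<in> B i \<Longrightarrow> coord i x b \<noteq> 0 \<Longrightarrow> string_of (i, b) = C"
    and b: "b \<in> B i" "coord i x b \<noteq> 0"
  shows "b \<in> U i"
proof -
  define S where "S = {b \<in> B i. coord i x b \<noteq> 0}"
  have S: "finite S" "b \<in> S" using b finite_B[OF i] by (auto simp: S_def)
  obtain b0 where b0: "b0 \<in> S" "\<And>d. d \<in> S \<Longrightarrow> height (i, b0) \<le> height (i, d)"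
    using arg_min_if_finite[of S "\<lambda>d. height (i, d)"] S by (metis empty_iff not_le)
  have V: "(i, d) \<in> verts CQ" "string_of (i, d) = C" if "d \<in> S" for d
    using that i C by (auto simp: S_def verts_CQ)
  have xsum: "x = (\<Sum>d\<in>S. coord i x d *\<^sub>M d)"
  proof -
    have "x = (\<Sum>d\<in>B i. coord i x d *\<^sub>M d)" using coord_sum[OF i] GrD(4)[OF U i] x by auto
    also have "\<dots> = (\<Sum>d\<in>S. coord i x d *\<^sub>M d)"
      by (rule sum.mono_neutral_right) (auto simp: S_def finite_B[OF i])
    finally show ?thesis .
  qed
  have "d \<in> above (i, b0)" if d: "d \<in> S - {b0}" for d
  proof -
    have "height (i, b0) \<noteq> height (i, d)"
      using vertex_eqI[OF V(1)[OF b0(1)] V(1)[of d]] V(2)[of b0] V(2)[of d] d b0(1) by auto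
    then show ?thesis using d b0 V(2)[of d] V(2)[OF b0(1)] by (force simp: above_def S_def)
  qed
  then have "(\<Sum>d\<in>S - {b0}. coord i x d *\<^sub>M d) \<in> span (above (i, b0))"
    by (intro span_sum span_scale span_base)
  moreover have "coord i x b0 *\<^sub>M b0 + (\<Sum>d\<in>S - {b0}. coord i x d *\<^sub>M d) = x"
    using xsum sum.remove[OF S(1) b0(1), of "\<lambda>d. coord i x d *\<^sub>M d"] by simp
  ultimately have "b0 \<in> U i"
    using uniserial_step[OF U V(1)[OF b0(1)], of "coord i x b0"] b0(1) x by (auto simp: S_def)
  moreover obtain k where "((i, b0), (i, b)) \<in> arcs_ends CQ ^^ k"
    using string_walk_height[OF V(1)[OF b0(1)] V(1)[OF S(2)]] V(2)[OF b0(1)] V(2)[OF S(2)] b0(2)[OF S(2)]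
      le_Suc_ex by metis
  ultimately show ?thesis using walk_in_subrep[OF U] by force
qed

text \<open>Otherwise the whole row is supported in the string of \<open>p\<close>, and
  \<open>uniserial_support\<close> puts \<open>q\<close> into
  \<open>U i \<inter> span N = {0}\<close>.\<close>

lemma crossing_entry:
  assumes U: "U \<in> Gr e" and i: "i \<in> verts Q" and N: "pivot_free i U N"
    and p: "p \<in> B i - N" and q: "q \<in> N" "entry i U N p q \<noteq> 0"
  shows "\<exists>q'\<in>N. entry i U N p q' \<noteq> 0 \<and> string_of (i, q') \<noteq> string_of (i, p)"
proof (rule ccontr)
  assume neg: "\<not> ?thesis"
  have NB: "N \<subseteq> B i" and N0: "U i \<inter> span N = {0}" using N unfolding pivot_free_def by auto
  let ?r = "echelon_row i U N p"
  have r: "?r \<in> U i" "\<And>b. b \<in> B i - N - {p} \<Longrightarrow> coord i ?r b = 0"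
    using echelon_row_iff[OF i GrD(3)[OF U i] GrD(4)[OF U i] N p, of ?r] by auto
  have "string_of (i, b) = string_of (i, p)" if "b \<in> B i" "coord i ?r b \<noteq> 0" for b
    using neg r(2) that by blast
  then have "q \<in> U i" using uniserial_support[OF U i r(1) _ _ q(2)] q(1) NB by blast
  then have "q = 0" using N0 q(1) span_base by blast
  then show False using dependent_zero[of "B i"] independent_B[OF i] q(1) NB by blast
qed

text \<open>Either two walks of equal length follow the same arrows, and then the two summands of a vector
  are transported together, or at the first difference one of the summands is annihilated.\<close>

lemma parallel_walks:
  assumes "fst v = fst w" "(v, v') \<in> arcs_ends CQ ^^ k" "(w, w') \<in> arcs_ends CQ ^^ k"
  shows "(\<exists>\<rho>. \<rho> \<noteq> 0 \<and> fst v' = fst w' \<and> (\<forall>U c. U \<in> Gr e \<longrightarrow> snd v + c *\<^sub>M snd w \<in> U (fst v) \<longrightarrow>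
      snd v' + (\<rho> * c) *\<^sub>M snd w' \<in> U (fst v'))) \<or>
    (\<forall>U c. U \<in> Gr e \<longrightarrow> snd v + c *\<^sub>M snd w \<in> U (fst v) \<longrightarrow> snd v' \<in> U (fst v'))"
  using assms
proof (induction k arbitrary: v w)
  case 0
  then show ?case by (intro disjI1 exI[of _ 1]) simp
next
  case (Suc k)
  obtain v1 where v1: "(v, v1) \<in> arcs_ends CQ" "(v1, v') \<in> arcs_ends CQ ^^ k"
    using relpow_Suc_D2[OF Suc.prems(2)] by blast
  obtain w1 where w1: "(w, w1) \<in> arcs_ends CQ" "(w1, w') \<in> arcs_ends CQ ^^ k"
    using relpow_Suc_D2[OF Suc.prems(3)] by blast
  obtain a x y where \<alpha>: "(a, x, y) \<in> arcs CQ" and v: "v = (tail Q a, x)" "v1 = (head Q a, y)"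
    using v1(1) by (rule arcs_ends_CQ)
  obtain a' x' y' where \<beta>: "(a', x', y') \<in> arcs CQ" and w: "w = (tail Q a', x')" "w1 = (head Q a', y')"
    using w1(1) by (rule arcs_ends_CQ)
  have a: "a \<in> arcs Q" "x \<in> B (tail Q a)" "x' \<in> B (tail Q a)"
    using \<alpha> \<beta> Suc.prems(1) by (auto simp: arcs_CQ v w)
  have xs: "x \<in> rep_space M (tail Q a)" "x' \<in> rep_space M (tail Q a)"
    using a by (auto intro: B_in_space)
  define \<mu> where "\<mu> = coord (head Q a) (rep_map M a x) y"
  have \<mu>: "\<mu> \<noteq> 0" "rep_map M a x = \<mu> *\<^sub>M y"
    using \<alpha> rep_map_arc[OF \<alpha>] by (auto simp: arcs_CQ \<mu>_def)
  have image: "rep_map M a x + c *\<^sub>M rep_map M a x' \<in> U (head Q a)"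
    if "U \<in> Gr e" "snd v + c *\<^sub>M snd w \<in> U (fst v)" for U c
    using GrD(6)[OF that(1) a(1), of "x + c *\<^sub>M x'"] that(2) xs a(1)
    by (simp add: v w rep_map_add rep_map_scale subspace_scale[OF rep_subspace])
  show ?case
  proof (cases "a = a'")
    case True
    \<comment> \<open>The factor \<open>\<nu> / \<mu>\<close> depends on the two arcs only. Hence
      \<rho> can be chosen before \<open>U\<close> and \<open>c\<close>, which later allows two
      subrepresentations to be compared.\<close>
    define \<nu> where "\<nu> = coord (head Q a) (rep_map M a x') y'"
    have \<nu>: "\<nu> \<noteq> 0" "rep_map M a x' = \<nu> *\<^sub>M y'"
      using \<beta> rep_map_arc[OF \<beta>] True by (auto simp: arcs_CQ \<nu>_def)
    have step: "snd v1 + (\<nu> / \<mu> * c) *\<^sub>M snd w1 \<in> U (fst v1)"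
      if U: "U \<in> Gr e" "snd v + c *\<^sub>M snd w \<in> U (fst v)" for U c
    proof -
      have "inverse \<mu> *\<^sub>M (\<mu> *\<^sub>M y + c *\<^sub>M \<nu> *\<^sub>M y') \<in> U (head Q a)"
        using image[OF U] a(1) unfolding \<mu>(2) \<nu>(2) by (intro subspace_scale[OF GrD(3)[OF U(1)]]) auto
      also have "inverse \<mu> *\<^sub>M (\<mu> *\<^sub>M y + c *\<^sub>M \<nu> *\<^sub>M y') = y + (\<nu> / \<mu> * c) *\<^sub>M y'"
        using \<mu>(1) by (simp add: scale_right_distrib field_simps)
      finally show ?thesis by (simp add: v w)
    qed
    have "fst v1 = fst w1" using True by (simp add: v w)
    from Suc.IH[OF this v1(2) w1(2)] show ?thesis
    proof (elim disjE exE conjE)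
      fix \<rho> assume \<rho>: "\<rho> \<noteq> 0" "fst v' = fst w'" "\<forall>U c. U \<in> Gr e \<longrightarrow> snd v1 + c *\<^sub>M snd w1 \<in> U (fst v1) \<longrightarrow>
          snd v' + (\<rho> * c) *\<^sub>M snd w' \<in> U (fst v')"
      have "snd v' + (\<rho> * (\<nu> / \<mu>) * c) *\<^sub>M snd w' \<in> U (fst v')"
        if "U \<in> Gr e" "snd v + c *\<^sub>M snd w \<in> U (fst v)" for U c
        using \<rho>(3)[rule_format, OF that(1) step[OF that]] by (simp add: mult.assoc)
      then show ?thesis
        using \<rho>(1,2) \<mu>(1) \<nu>(1) by (intro disjI1 exI[of _ "\<rho> * (\<nu> / \<mu>)"]) simp
    next
      assume "\<forall>U c. U \<in> Gr e \<longrightarrow> snd v1 + c *\<^sub>M snd w1 \<in> U (fst v1) \<longrightarrow> snd v' \<in> U (fst v')"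
      then show ?thesis using step by blast
    qed
  next
    case False
    \<comment> \<open>The only arc leaving \<open>x'\<close> lies over \<open>a'\<close>, so the map
      of \<open>a\<close> annihilates \<open>x'\<close> and leaves a multiple of
      \<open>y\<close>.\<close>
    have "(a, x', z) \<notin> arcs CQ" for z
    proof
      assume "(a, x', z) \<in> arcs CQ"
      from CQ.string_out_unique[OF strings this \<beta>] show False
        using False Suc.prems(1) by (simp add: v w)
    qed
    then have "rep_map M a x' = 0" using rep_map_no_arc[OF a(1,3)] by blast
    then have "snd v' \<in> U (fst v')" if U: "U \<in> Gr e" "snd v + c *\<^sub>M snd w \<in> U (fst v)" for U c
    proof -
      have "inverse \<mu> *\<^sub>M rep_map M a x \<in> U (head Q a)"
        using image[OF U] a(1) \<open>rep_map M a x' = 0\<close>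
        by (intro subspace_scale[OF GrD(3)[OF U(1)]]) auto
      then have "snd v1 \<in> U (fst v1)" using \<mu> by (simp add: v)
      then show ?thesis by (rule walk_in_subrep[OF U(1) v1(2)])
    qed
    then show ?thesis by blast
  qed
qed

end


section \<open>Finitely many one-dimensional orbits\<close>

lemma (in vector_space) in_subspace_coefficient_unique:
  assumes "subspace W" "x + scale c y \<in> W" "x + scale d y \<in> W" "y \<notin> W"
  shows "c = d"
proof (rule ccontr)
  assume "c \<noteq> d"
  have "scale (c - d) y \<in> W"
    using subspace_diff[OF assms(1-3)] by (simp add: scale_left_diff_distrib)
  then have "scale (inverse (c - d)) (scale (c - d) y) \<in> W" by (rule subspace_scale[OF assms(1)])
  then show False using \<open>c \<noteq> d\<close> assms(4) by simp
qed

lemma (in vector_space) in_subspace_swap_coefficient: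
  assumes "subspace W" "x + scale c y \<in> W" "c \<noteq> 0"
  shows "y + scale (inverse c) x \<in> W"
proof -
  have "scale (inverse c) (x + scale c y) = y + scale (inverse c) x"
    using assms(3) by (simp add: scale_right_distrib add.commute)
  then show ?thesis using subspace_scale[OF assms(1,2), of "inverse c"] by simp
qed

section \<open>Pairs of basis vectors shifted along two strings, and supports of echelon
  forms\<close>

context straight_rep
begin

text \<open>The second pair arises from the first by the same shift along both strings, possibly
  backwards; sums of heights avoid subtraction of natural numbers.\<close>

definition aligned :: "'v \<times> 'm \<Rightarrow> 'v \<times> 'm \<Rightarrow> 'v \<times> 'm \<Rightarrow> 'v \<times> 'm \<Rightarrow> bool" where
  "aligned v w v' w' \<longleftrightarrow> string_of v' = string_of v \<and> string_of w' = string_of w \<and>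
    height v' + height w = height w' + height v"

text \<open>Two kinds of test exponents suffice: one sees the strings outside the two given ones,
  the other compares heights.\<close>

lemma aligned_if_wt_degree_eq:
  assumes V: "v' \<in> verts CQ" "w' \<in> verts CQ"
    and ne: "string_of v \<noteq> string_of w" "v' \<noteq> w'"
    and deg: "\<And>n m. wt_degree n m v = wt_degree n m w \<Longrightarrow> wt_degree n m v' = wt_degree n m w'"
  shows "aligned v w v' w' \<or> aligned v w w' v'"
proof -
  let ?s = "string_of v" and ?r = "string_of w"
  \<comment> \<open>Scaling only a third string \<open>C\<close> fixes the ratio of \<open>v\<close>
    and \<open>w\<close>, so \<open>C\<close> contains both or neither of \<open>v'\<close>,
    \<open>w'\<close>.\<close>
  have other: "string_of v' = C \<longleftrightarrow> string_of w' = C" if "C \<noteq> ?s" "C \<noteq> ?r" for C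
    using deg[of "\<lambda>D. if D = C then 1 else 0" 0] that by (auto simp: wt_degree_def split: if_splits)
  \<comment> \<open>Crossing over the heights gives \<open>v\<close> and \<open>w\<close> the common
    degree \<open>height v + height w\<close> when the arrows have exponent 1.\<close>
  define n where "n = (\<lambda>D. if D = ?s then height w else if D = ?r then height v else 0)"
  have h: "n (string_of v') + height v' = n (string_of w') + height w'"
    using deg[of n 1] ne(1) by (simp add: wt_degree_def n_def)
  have "string_of v' \<noteq> string_of w'"
    using h vertex_eqI[OF V] ne(2) by auto
  then have "string_of v' = ?s \<and> string_of w' = ?r \<or> string_of v' = ?r \<and> string_of w' = ?s"
    using other by metis
  then show ?thesis
    using h ne(1) unfolding aligned_def n_def by auto
qed

text \<open>The walks go from the lower pair to the higher one, and the same \<rho> serves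
  \<open>U\<close> and \<open>W\<close>. The non-memberships exclude the degenerate alternative of
  \<open>parallel_walks\<close> and make the coefficient of the target pair unique; in the backward
  case \<rho> has to be cancelled.\<close>

lemma aligned_coefficients_eq:
  assumes V: "v \<in> verts CQ" "w \<in> verts CQ" "v' \<in> verts CQ" "w' \<in> verts CQ"
    and fst: "fst v = fst w" "fst v' = fst w'" and al: "aligned v w v' w'"
    and U: "U \<in> Gr e" "snd v + c *\<^sub>M snd w \<in> U (fst v)" "snd v' + d *\<^sub>M snd w' \<in> U (fst v')"
    and nU: "snd v \<notin> U (fst v)" "snd w \<notin> U (fst v)" "snd v' \<notin> U (fst v')" "snd w' \<notin> U (fst v')"
    and W: "W \<in> Gr e" "snd v + c *\<^sub>M snd w \<in> W (fst v)" "snd v' + d' *\<^sub>M snd w' \<in> W (fst v')"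
    and nW: "snd v \<notin> W (fst v)" "snd w \<notin> W (fst v)" "snd v' \<notin> W (fst v')" "snd w' \<notin> W (fst v')"
  shows "d = d'"
proof (cases "height v \<le> height v'")
  case True
  then obtain k where k: "height v' = height v + k" using le_Suc_ex by blast
  with al have k': "height w' = height w + k" by (simp add: aligned_def)
  have walks: "(v, v') \<in> arcs_ends CQ ^^ k" "(w, w') \<in> arcs_ends CQ ^^ k"
    using string_walk_height[OF V(1,3) _ k] string_walk_height[OF V(2,4) _ k'] al
    by (simp_all add: aligned_def)
  have i: "fst v' \<in> verts Q" using V(3) by (auto simp: verts_CQ)
  obtain \<rho> where \<rho>: "\<And>U c. U \<in> Gr e \<Longrightarrow> snd v + c *\<^sub>M snd w \<in> U (fst v) \<Longrightarrow>
      snd v' + (\<rho> * c) *\<^sub>M snd w' \<in> U (fst v')"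
    using parallel_walks[OF fst(1) walks, of e] U(1,2) nU(3) by blast
  have "\<rho> * c = d"
    by (rule in_subspace_coefficient_unique[OF GrD(3)[OF U(1) i] \<rho>[OF U(1,2)] U(3) nU(4)])
  moreover have "\<rho> * c = d'"
    by (rule in_subspace_coefficient_unique[OF GrD(3)[OF W(1) i] \<rho>[OF W(1,2)] W(3) nW(4)])
  ultimately show ?thesis by simp
next
  case False
  then obtain k where k: "height v = height v' + k" using le_Suc_ex[of "height v'" "height v"] by auto
  with al have k': "height w = height w' + k" by (simp add: aligned_def)
  have walks: "(v', v) \<in> arcs_ends CQ ^^ k" "(w', w) \<in> arcs_ends CQ ^^ k"
    using string_walk_height[OF V(3,1) _ k] string_walk_height[OF V(4,2) _ k'] al
    by (simp_all add: aligned_def)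
  have i: "fst v \<in> verts Q" using V(1) by (auto simp: verts_CQ)
  obtain \<rho> where \<rho>: "\<rho> \<noteq> 0" "\<And>U c. U \<in> Gr e \<Longrightarrow> snd v' + c *\<^sub>M snd w' \<in> U (fst v') \<Longrightarrow>
      snd v + (\<rho> * c) *\<^sub>M snd w \<in> U (fst v)"
    using parallel_walks[OF fst(2) walks, of e] U(1,3) nU(1) by blast
  have "\<rho> * d = c"
    by (rule in_subspace_coefficient_unique[OF GrD(3)[OF U(1) i] \<rho>(2)[OF U(1,3)] U(2) nU(2)])
  moreover have "\<rho> * d' = c"
    by (rule in_subspace_coefficient_unique[OF GrD(3)[OF W(1) i] \<rho>(2)[OF W(1,3)] W(2) nW(2)])
  ultimately show ?thesis using \<rho>(1) by auto
qed

definition entry_support :: "('v \<Rightarrow> 'm set) \<Rightarrow> ('v \<Rightarrow> 'm set) \<Rightarrow> ('v \<times> 'm \<times> 'm) set" where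
  "entry_support U N =
    {(i, p, q). i \<in> verts Q \<and> p \<in> B i - N i \<and> q \<in> N i \<and> entry i U (N i) p q \<noteq> 0}"

text \<open>A condition on positions only, so it can be shared by different subrepresentations. The
  empty support satisfies it, which does no harm to the counting.\<close>

definition rank_one_support :: "('v \<times> 'm \<times> 'm) set \<Rightarrow> bool" where
  "rank_one_support E \<longleftrightarrow> (\<forall>i p q i' p' q' n m. (i, p, q) \<in> E \<longrightarrow> (i', p', q') \<in> E \<longrightarrow>
    string_of (i, p) \<noteq> string_of (i, q) \<longrightarrow> wt_degree n m (i, p) = wt_degree n m (i, q) \<longrightarrow>
    wt_degree n m (i', p') = wt_degree n m (i', q'))"

lemma rank_one_support_aligned:
  assumes E: "rank_one_support E" "E \<subseteq> (SIGMA i:verts Q. B i \<times> B i)"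
    and e: "(i, p, q) \<in> E" "string_of (i, p) \<noteq> string_of (i, q)" "(i', p', q') \<in> E" "p' \<noteq> q'"
  shows "aligned (i, p) (i, q) (i', p') (i', q') \<or> aligned (i, p) (i, q) (i', q') (i', p')"
proof (rule aligned_if_wt_degree_eq)
  show "(i', p') \<in> verts CQ" "(i', q') \<in> verts CQ" using E(2) e(3) by (auto simp: verts_CQ)
  show "wt_degree n m (i', p') = wt_degree n m (i', q')"
    if "wt_degree n m (i, p) = wt_degree n m (i, q)" for n m
    using E(1) e that unfolding rank_one_support_def by blast
qed (use e in simp_all)

lemma entry_support_subset:
  assumes "\<And>i. i \<in> verts Q \<Longrightarrow> pivot_free i U (N i)"
  shows "entry_support U N \<subseteq> (SIGMA i:verts Q. B i \<times> B i)"
  using assms by (auto simp: entry_support_def pivot_free_def)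

text \<open>As the two strings differ, the string of \<open>x\<close> tells which end of the pair it
  is; string and height of the partner are then determined.\<close>

lemma aligned_unique:
  assumes V: "x \<in> verts CQ" "y \<in> verts CQ" "z \<in> verts CQ" and vw: "string_of v \<noteq> string_of w"
    and xy: "aligned v w x y \<or> aligned v w y x" and xz: "aligned v w x z \<or> aligned v w z x"
  shows "y = z"
  by (rule vertex_eqI[OF V(2,3)]) (use xy xz vw in \<open>auto simp: aligned_def\<close>)

lemma echelon_row_eq_pair:
  assumes U: "U \<in> Gr e" and i: "i \<in> verts Q" and N: "pivot_free i U N"
    and p: "p \<in> B i - N" and q: "q \<in> N" and other: "\<And>b. b \<in> N \<Longrightarrow> b \<noteq> q \<Longrightarrow> entry i U N p b = 0"
  shows "echelon_row i U N p = p + entry i U N p q *\<^sub>M q"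
proof (rule coord_eqI[OF i])
  have NB: "N \<subseteq> B i" using N unfolding pivot_free_def by blast
  have pq: "p \<in> B i" "q \<in> B i" "p \<in> rep_space M i" "q \<in> rep_space M i" "p \<noteq> q"
    using p q NB B_in_space[OF i] by auto
  have r: "echelon_row i U N p \<in> U i" "entry i U N p p = 1"
      "\<And>b. b \<in> B i - N - {p} \<Longrightarrow> entry i U N p b = 0"
    using echelon_row_iff[OF i GrD(3)[OF U i] GrD(4)[OF U i] N p, of "echelon_row i U N p"] by auto
  show "echelon_row i U N p \<in> rep_space M i" using r(1) GrD(4)[OF U i] by blast
  show "p + entry i U N p q *\<^sub>M q \<in> rep_space M i"
    using pq i by (intro subspace_add[OF rep_subspace] subspace_scale[OF rep_subspace]) auto
  fix b assume b: "b \<in> B i"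
  have "coord i (p + entry i U N p q *\<^sub>M q) b =
      (if b = p then 1 else 0) + entry i U N p q * (if b = q then 1 else 0)"
    using pq i by (simp add: coord_add coord_scale coord_basis subspace_scale[OF rep_subspace])
  then show "entry i U N p b = coord i (p + entry i U N p q *\<^sub>M q) b"
    using r(2) r(3)[of b] other[of b] b pq(5) by auto
qed

text \<open>These are the non-memberships required by \<open>aligned_coefficients_eq\<close>. If
  \<open>p\<close> were in \<open>U i\<close>, it would be its own row and all its entries at
  non-pivots would vanish.\<close>

lemma pivots_notin:
  assumes U: "U \<in> Gr e" and i: "i \<in> verts Q" and N: "pivot_free i U N"
    and p: "p \<in> B i - N" and q: "q \<in> N" and nz: "entry i U N p q \<noteq> 0"
  shows "p \<notin> U i" "q \<notin> U i"
proof -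
  have NB: "N \<subseteq> B i" and N0: "U i \<inter> span N = {0}" using N unfolding pivot_free_def by auto
  show "q \<notin> U i"
  proof
    assume "q \<in> U i"
    then have "q = 0" using N0 q span_base by blast
    then show False using dependent_zero[of "B i"] independent_B[OF i] q NB by blast
  qed
  show "p \<notin> U i"
  proof
    assume "p \<in> U i"
    then have "echelon_row i U N p = p"
      using echelon_row_eqI[OF GrD(3)[OF U i] N p] by (simp add: span_zero)
    then have "coord i p q \<noteq> 0" using nz by simp
    then show False using coord_basis[OF i, of p q] p q by (auto split: if_splits)
  qed
qed

text \<open>The reference entry at \<open>(i0, p0, q0)\<close> determines all others: its pair is
  aligned with every further pair of the support, so transport gives equal coefficients in
  \<open>U\<close> and \<open>W\<close>. Equal rows then give equal spaces.\<close>

lemma rank_one_support_eq: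
  assumes U: "U \<in> Gr e" "\<And>i. i \<in> verts Q \<Longrightarrow> pivot_free i U (N i)"
    and W: "W \<in> Gr e" "\<And>i. i \<in> verts Q \<Longrightarrow> pivot_free i W (N i)"
    and E: "entry_support U N = entry_support W N" "rank_one_support (entry_support U N)"
    and e0: "entry_support U N \<noteq> {} \<Longrightarrow> (i0, p0, q0) \<in> entry_support U N \<and>
      string_of (i0, p0) \<noteq> string_of (i0, q0) \<and> entry i0 U (N i0) p0 q0 = entry i0 W (N i0) p0 q0"
  shows "U = W"
proof -
  note sub = entry_support_subset[OF U(2)]
  have mem: "entry i V (N i) p q \<noteq> 0 \<longleftrightarrow> (i, p, q) \<in> entry_support V N"
    if "i \<in> verts Q" "p \<in> B i - N i" "q \<in> N i" for V i p q
    using that by (simp add: entry_support_def)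
  have support: "entry i U (N i) p q \<noteq> 0 \<longleftrightarrow> (i, p, q) \<in> entry_support U N"
      "entry i W (N i) p q \<noteq> 0 \<longleftrightarrow> (i, p, q) \<in> entry_support U N"
    if "i \<in> verts Q" "p \<in> B i - N i" "q \<in> N i" for i p q
    using mem[OF that, of U] mem[OF that, of W] E(1) by simp_all
  have rows: "echelon_row i U (N i) p = echelon_row i W (N i) p"
    if i: "i \<in> verts Q" and p: "p \<in> B i - N i" for i p
  proof (cases "\<exists>q. (i, p, q) \<in> entry_support U N")
    case False
    have "echelon_row i V (N i) p = p"
      if V: "V \<in> Gr e" "pivot_free i V (N i)" and z: "\<And>q. q \<in> N i \<Longrightarrow> entry i V (N i) p q = 0" for V
    proof (rule coord_eqI[OF i])
      note r = echelon_row_iff[OF i GrD(3)[OF V(1) i] GrD(4)[OF V(1) i] V(2) p,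
          of "echelon_row i V (N i) p", simplified]
      show "echelon_row i V (N i) p \<in> rep_space M i" using r GrD(4)[OF V(1) i] by blast
      show "p \<in> rep_space M i" using p B_in_space[OF i] by blast
      fix b assume "b \<in> B i"
      then show "entry i V (N i) p b = coord i p b"
        using r z[of b] p by (cases "b \<in> N i") (auto simp: coord_basis[OF i])
    qed
    from this[OF U(1) U(2)[OF i]] this[OF W(1) W(2)[OF i]] show ?thesis
      using False support[OF i p] by metis
  next
    case True
    then obtain q where q: "(i, p, q) \<in> entry_support U N" by blast
    then have qN: "q \<in> N i" by (simp add: entry_support_def)
    have e0': "(i0, p0, q0) \<in> entry_support U N" "string_of (i0, p0) \<noteq> string_of (i0, q0)"
        "entry i0 U (N i0) p0 q0 = entry i0 W (N i0) p0 q0"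
      using e0 q by blast+
    \<comment> \<open>A pivot has only one possible partner, so a row has at most one nonzero entry
      at a non-pivot.\<close>
    have uniq: "(i, p, b) \<notin> entry_support U N" if e: "(i', p', q') \<in> entry_support U N"
        "i = i'" "p = p'" "b \<in> N i" "b \<noteq> q'" for i' p' q' b i p
    proof
      assume b: "(i, p, b) \<in> entry_support U N"
      have ne: "p \<noteq> b" "p \<noteq> q'" using b e by (auto simp: entry_support_def)
      have "(i, b) = (i, q')"
        by (rule aligned_unique[OF _ _ _ e0'(2)
              rank_one_support_aligned[OF E(2) sub e0'(1,2) b ne(1)]
              rank_one_support_aligned[OF E(2) sub e0'(1,2) e(1)[folded e(2,3)] ne(2)]])
          (use b e sub in \<open>auto simp: verts_CQ\<close>)
      then show False using e by simp
    qed
    have pair: "echelon_row i' V (N i') p' = p' + entry i' V (N i') p' q' *\<^sub>M q'"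
        "entry i' V (N i') p' q' \<noteq> 0"
        "p' \<notin> V i'" "q' \<notin> V i'" "p' + entry i' V (N i') p' q' *\<^sub>M q' \<in> V i'"
      if e: "(i', p', q') \<in> entry_support U N" and V: "V = U \<or> V = W" for i' p' q' V
    proof -
      have i': "i' \<in> verts Q" "p' \<in> B i' - N i'" "q' \<in> N i'"
        using e by (simp_all add: entry_support_def)
      have VG: "V \<in> Gr e" "pivot_free i' V (N i')" using V U(1) W(1) U(2)[OF i'(1)] W(2)[OF i'(1)] by auto
      show nz: "entry i' V (N i') p' q' \<noteq> 0" using support[OF i'] e V by auto
      show row: "echelon_row i' V (N i') p' = p' + entry i' V (N i') p' q' *\<^sub>M q'"
      proof (rule echelon_row_eq_pair[OF VG(1) i'(1) VG(2) i'(2,3)])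
        fix b assume "b \<in> N i'" "b \<noteq> q'"
        then show "entry i' V (N i') p' b = 0"
          using support[OF i'(1,2), of b] uniq[OF e refl refl] V by auto
      qed
      show "p' \<notin> V i'" "q' \<notin> V i'" using pivots_notin[OF VG(1) i'(1) VG(2) i'(2,3) nz] .
      show "p' + entry i' V (N i') p' q' *\<^sub>M q' \<in> V i'"
        using echelon_row(1)[OF VG(2) i'(2)] row by simp
    qed
    have V: "(i0, p0) \<in> verts CQ" "(i0, q0) \<in> verts CQ" "(i, p) \<in> verts CQ" "(i, q) \<in> verts CQ"
      using sub e0'(1) q by (auto simp: verts_CQ)
    note PU = pair[OF q disjI1[OF refl]] and PW = pair[OF q disjI2[OF refl]]
      and P0U = pair[OF e0'(1) disjI1[OF refl]] and P0W = pair[OF e0'(1) disjI2[OF refl], folded e0'(3)]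
    let ?k = "entry i0 U (N i0) p0 q0" and ?c = "entry i U (N i) p q" and ?d = "entry i W (N i) p q"
    have "p \<noteq> q" using q by (auto simp: entry_support_def)
    from rank_one_support_aligned[OF E(2) sub e0'(1,2) q this]
    have "?c = ?d"
    proof
      assume al: "aligned (i0, p0) (i0, q0) (i, p) (i, q)"
      show ?thesis
        by (rule aligned_coefficients_eq[where c = ?k, OF V _ _ al U(1) _ _ _ _ _ _ W(1)])
          (use PU(3-5) PW(3-5) P0U(3-5) P0W(3-5) in simp_all)
    next
      assume al: "aligned (i0, p0) (i0, q0) (i, q) (i, p)"
      \<comment> \<open>Here the pivot lies in the other string than \<open>p0\<close>, so the row
        is rescaled to have coefficient 1 at \<open>q\<close>, which inverts the entry.\<close>
      have "inverse ?c = inverse ?d"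
        by (rule aligned_coefficients_eq[where c = ?k, OF V(1,2,4,3) _ _ al U(1) _ _ _ _ _ _ W(1)])
          (use PU(3,4) PW(3,4) P0U(3-5) P0W(3-5) in_subspace_swap_coefficient[OF GrD(3)[OF U(1) i] PU(5,2)]
            in_subspace_swap_coefficient[OF GrD(3)[OF W(1) i] PW(5,2)] in simp_all)
      then show ?thesis by simp
    qed
    then show ?thesis using PU(1) PW(1) by simp
  qed
  show ?thesis
  proof (rule extensionalityI[OF GrD(2)[OF U(1)] GrD(2)[OF W(1)]])
    fix i assume i: "i \<in> verts Q"
    note iU = GrD(3,4)[OF U(1) i] U(2)[OF i] and iW = GrD(3,4)[OF W(1) i] W(2)[OF i]
    show "U i = W i"
      using subspace_eq_if_rows_eq[OF i iU iW(1,3)] subspace_eq_if_rows_eq[OF i iW iU(1,3)] rows[OF i]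
      by (metis subset_antisym)
  qed
qed

text \<open>By \<open>crossing_entry\<close> a nonempty support has an entry between two different
  strings. A torus element adjusting this one entry leaves the support unchanged, and
  \<open>rank_one_support_eq\<close> does the rest.\<close>

lemma rank_one_same_orbit:
  assumes U: "U \<in> Gr e" "\<And>i. i \<in> verts Q \<Longrightarrow> pivot_free i U (N i)"
    and W: "W \<in> Gr e" "\<And>i. i \<in> verts Q \<Longrightarrow> pivot_free i W (N i)"
    and E: "entry_support U N = entry_support W N" "rank_one_support (entry_support U N)"
  shows "\<exists>t\<in>carrier torus. act e t U = W"
proof (cases "entry_support U N = {}")
  case True
  then have "U = W" using rank_one_support_eq[OF U W E] by blast
  then show ?thesis using act_one[OF U(1)] group.is_monoid[OF group_torus] monoid.one_closed by blast
next
  case False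
  then obtain i p q where pq: "(i, p, q) \<in> entry_support U N" by auto
  then obtain q0 where i: "i \<in> verts Q" "p \<in> B i - N i" "q0 \<in> N i" "entry i U (N i) p q0 \<noteq> 0"
    and ne: "string_of (i, p) \<noteq> string_of (i, q0)"
    using crossing_entry[OF U(1) _ U(2)] by (fastforce simp: entry_support_def)
  then have e0: "(i, p, q0) \<in> entry_support U N" by (simp add: entry_support_def)
  then have nzW: "entry i W (N i) p q0 \<noteq> 0" unfolding E(1) by (simp add: entry_support_def)
  define \<kappa> where "\<kappa> = entry i W (N i) p q0 / entry i U (N i) p q0"
  \<comment> \<open>It scales only the string of \<open>q0\<close>, so the entry at
    \<open>(p, q0)\<close> is multiplied by exactly \<kappa>.\<close>
  define t where "t = one_param (\<lambda>C. if C = string_of (i, q0) then 1 else 0) 0 \<kappa>"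
  have t: "t \<in> carrier torus"
    unfolding t_def using nzW i(4) by (intro one_param_carrier) (simp add: \<kappa>_def)
  have pf: "pivot_free j (act e t U) (N j)" if "j \<in> verts Q" for j
    by (rule act_echelon(1)[OF t U(1) that U(2)[OF that]])
  have NB: "N j \<subseteq> B j" if "j \<in> verts Q" for j using U(2)[OF that] unfolding pivot_free_def by blast
  have ent: "entry j (act e t U) (N j) a b = weight t (j, b) / weight t (j, a) * entry j U (N j) a b"
    if "j \<in> verts Q" "a \<in> B j - N j" "b \<in> N j" for j a b
    using act_echelon(2)[OF t U(1) that(1) U(2)[OF that(1)] that(2)] NB that by blast
  have supp: "entry_support (act e t U) N = entry_support U N"
  proof -
    have "entry j (act e t U) (N j) a b \<noteq> 0 \<longleftrightarrow> entry j U (N j) a b \<noteq> 0"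
      if j: "j \<in> verts Q" "a \<in> B j - N j" "b \<in> N j" for j a b
    proof -
      have "weight t (j, b) \<noteq> 0" "weight t (j, a) \<noteq> 0"
        using weight_nonzero[OF t] j NB[OF j(1)] by (auto simp: verts_CQ)
      then show ?thesis by (simp add: ent[OF j])
    qed
    then show ?thesis unfolding entry_support_def by blast
  qed
  have V: "(i, p) \<in> verts CQ" "(i, q0) \<in> verts CQ" using i NB[OF i(1)] by (auto simp: verts_CQ)
  have "entry i (act e t U) (N i) p q0 = entry i W (N i) p q0"
    unfolding ent[OF i(1-3)] using V ne i(4)
    by (simp add: t_def weight_one_param wt_degree_def \<kappa>_def)
  then have "act e t U = W"
    using rank_one_support_eq[OF act_closed[OF t U(1)] pf W, of i p q0] supp E e0 ne by simp
  then show ?thesis using t by blast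
qed

lemma one_dimensional_rank_one:
  assumes U: "U \<in> Gr e" "\<And>i. i \<in> verts Q \<Longrightarrow> pivot_free i U (N i)"
    and dim: "krull_dim (subtopology (quiver_grassmannian_zariski Q M e)
      (Group_Action.orbit torus (act e) U)) = 1"
  shows "rank_one_support (entry_support U N)"
  unfolding rank_one_support_def
proof (intro allI impI, rule ccontr)
  fix i p q i' p' q' n m
  assume e: "(i, p, q) \<in> entry_support U N" "(i', p', q') \<in> entry_support U N"
    and ne: "string_of (i, p) \<noteq> string_of (i, q)"
    and d: "wt_degree n m (i, p) = wt_degree n m (i, q)" "wt_degree n m (i', p') \<noteq> wt_degree n m (i', q')"
  from e have "i \<in> verts Q" "p \<in> B i - N i" "q \<in> N i" "entry i U (N i) p q \<noteq> 0"
      "i' \<in> verts Q" "p' \<in> B i' - N i'" "q' \<in> N i'" "entry i' U (N i') p' q' \<noteq> 0"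
    by (simp_all add: entry_support_def)
  then show False
    using krull_dim_orbit_ne_1[OF U(1), of i "N i" p q i' "N i'" p' q' n m] U(2) ne d dim by blast
qed

lemma orbit_eqI:
  assumes U: "U \<in> Gr e" and t: "t \<in> carrier torus"
  shows "Group_Action.orbit torus (act e) (act e t U) = Group_Action.orbit torus (act e) U"
proof -
  interpret T: Group.group torus by (rule group_torus)
  show ?thesis
  proof (intro subset_antisym subsetI)
    fix W assume "W \<in> Group_Action.orbit torus (act e) (act e t U)"
    then obtain s where s: "s \<in> carrier torus" "W = act e s (act e t U)"
      unfolding Group_Action.orbit_def by blast
    then have "W = act e (s \<otimes>\<^bsub>torus\<^esub> t) U" using act_mult[OF s(1) t U] by simp
    then show "W \<in> Group_Action.orbit torus (act e) U"
      unfolding Group_Action.orbit_def using T.m_closed[OF s(1) t] by blast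
  next
    fix W assume "W \<in> Group_Action.orbit torus (act e) U"
    then obtain s where s: "s \<in> carrier torus" "W = act e s U"
      unfolding Group_Action.orbit_def by blast
    have st: "s \<otimes>\<^bsub>torus\<^esub> inv\<^bsub>torus\<^esub> t \<in> carrier torus" using s(1) t by simp
    have "W = act e (s \<otimes>\<^bsub>torus\<^esub> inv\<^bsub>torus\<^esub> t) (act e t U)"
      using s t by (simp add: T.m_assoc flip: act_mult[OF st t U])
    then show "W \<in> Group_Action.orbit torus (act e) (act e t U)"
      unfolding Group_Action.orbit_def using st by blast
  qed
qed

text \<open>Each such orbit is sent to the non-pivots and the support of a chosen representative.
  This map is injective by \<open>rank_one_same_orbit\<close> and has values in a finite
  set.\<close>

lemma finite_one_dimensional_orbits:
  "finite {X \<in> orbits torus (Gr e) (act e). krull_dim (subtopology (quiver_grassmannian_zariski Q M e) X) = 1}"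
  (is "finite ?O")
proof -
  have "\<exists>U N. U \<in> Gr e \<and> X = Group_Action.orbit torus (act e) U \<and> (\<forall>i\<in>verts Q. pivot_free i U (N i)) \<and>
      rank_one_support (entry_support U N)" if X: "X \<in> ?O" for X
  proof -
    obtain U where U: "U \<in> Gr e" "X = Group_Action.orbit torus (act e) U"
      using X unfolding orbits_def by blast
    have "\<forall>i\<in>verts Q. \<exists>N. pivot_free i U N" using pivot_free_exists GrD(3)[OF U(1)] by blast
    then obtain N where N: "\<forall>i\<in>verts Q. pivot_free i U (N i)" by (elim bchoice[elim_format] exE)
    have "rank_one_support (entry_support U N)"
      using one_dimensional_rank_one[OF U(1)] N X U(2) by blast
    then show ?thesis using U N by blast
  qed
  then have "\<forall>X\<in>?O. \<exists>z. fst z \<in> Gr e \<and> X = Group_Action.orbit torus (act e) (fst z) \<and>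
      (\<forall>i\<in>verts Q. pivot_free i (fst z) (snd z i)) \<and> rank_one_support (entry_support (fst z) (snd z))"
    by simp
  then obtain \<Phi> where \<Phi>: "\<forall>X\<in>?O. fst (\<Phi> X) \<in> Gr e \<and> X = Group_Action.orbit torus (act e) (fst (\<Phi> X)) \<and>
      (\<forall>i\<in>verts Q. pivot_free i (fst (\<Phi> X)) (snd (\<Phi> X) i)) \<and>
      rank_one_support (entry_support (fst (\<Phi> X)) (snd (\<Phi> X)))"
    by (elim bchoice[elim_format] exE)
  \<comment> \<open>The family of non-pivots is arbitrary outside \<open>verts Q\<close>;
    \<open>Sigma\<close> records only its values at the vertices.\<close>
  define type where "type X = (Sigma (verts Q) (snd (\<Phi> X)), entry_support (fst (\<Phi> X)) (snd (\<Phi> X)))" for X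
  have "inj_on type ?O"
  proof (rule inj_onI)
    fix X Y assume X: "X \<in> ?O" and Y: "Y \<in> ?O" and eq: "type X = type Y"
    obtain U N where UN: "\<Phi> X = (U, N)" by fastforce
    obtain W N' where WN: "\<Phi> Y = (W, N')" by fastforce
    note X' = \<Phi>[rule_format, OF X, unfolded UN fst_conv snd_conv]
      and Y' = \<Phi>[rule_format, OF Y, unfolded WN fst_conv snd_conv]
    have "Sigma (verts Q) N = Sigma (verts Q) N'" and E: "entry_support U N = entry_support W N'"
      using eq by (simp_all add: type_def UN WN)
    then have NN: "N i = N' i" if "i \<in> verts Q" for i using that by auto
    \<comment> \<open>Agreement at the vertices is enough to use the non-pivots \<open>N\<close> of
      \<open>X\<close> for \<open>W\<close> as well.\<close>
    then have "entry_support W N' = entry_support W N" by (auto simp: entry_support_def)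
    then have "\<exists>t\<in>carrier torus. act e t U = W"
      using rank_one_same_orbit[of U e N W] X' Y' E NN by simp
    then show "X = Y" using orbit_eqI[of U e] X' Y' by auto
  qed
  moreover have "type ` ?O \<subseteq> Pow (verts CQ) \<times> Pow (SIGMA i:verts Q. B i \<times> B i)"
  proof
    fix y assume "y \<in> type ` ?O"
    then obtain X where X: "X \<in> ?O" "y = type X" by blast
    have "\<forall>i\<in>verts Q. snd (\<Phi> X) i \<subseteq> B i"
      using \<Phi>[rule_format, OF X(1)] by (simp add: pivot_free_def)
    then show "y \<in> Pow (verts CQ) \<times> Pow (SIGMA i:verts Q. B i \<times> B i)"
      using entry_support_subset[of "fst (\<Phi> X)" "snd (\<Phi> X)"] \<Phi>[rule_format, OF X(1)]
      by (auto simp: X(2) type_def verts_CQ)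
  qed
  moreover have "finite (Pow (verts CQ) \<times> Pow (SIGMA i:verts Q. B i \<times> B i))"
    using finite_B by simp
  ultimately show ?thesis by (rule inj_on_finite)
qed

end

theorem theorem4p13:
  fixes Q :: "('v, 'a) pre_digraph"
    and M :: "('v, 'a, 'm::ab_group_add) quiver_rep"
    and B :: "'v \<Rightarrow> 'm set"
    and e :: "'v \<Rightarrow> int"
  assumes "quiver_representation Q M"
    and "straight Q M"
    and "straightening_basis Q M B"
  shows "group_action (rep_torus Q M B) (quiver_grassmannian Q M e) (torus_action Q M B e) \<and>
    finite {X \<in> orbits (rep_torus Q M B) (quiver_grassmannian Q M e) (torus_action Q M B e).
      krull_dim (subtopology (quiver_grassmannian_zariski Q M e) X) = 1}"
proof -
  have "straight_rep Q M B"
    using assms(1,3) by (simp add: straight_rep_def straight_rep_axioms_def)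
  then show ?thesis
    using straight_rep.group_action_torus straight_rep.finite_one_dimensional_orbits by blast
qed

end
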